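(* Let $H:\mathbb R\to\mathbb R$ be smooth, convex and coercive, i.e. $\lim_{|p|\to\infty}H(p)=+\infty$, and let $u_0:\mathbb T\to\mathbb R$ be smooth. Let $R>0$ be such that $\|(u_0)_x\|_{L^\infty(\mathbb T)}\le R$, let $\gamma>0$ be a constant with $|H'(p)|\le 2\gamma$ for all $|p|\le R$, and let $$F(p,q)=H\Big(\frac{q-p}{2}\Big)+\gamma(p+q),\qquad (p,q)\in\mathbb R^2 .$$ For every $h>0$ let $u^h:\mathbb T\times[0,\infty)\to\mathbb R$ be the solution of $$u^h_t+F(-\delta_h u^h,\delta_{-h}u^h)=0\ \text{ in }\mathbb T\times(0,\infty),\qquad u^h=u_0\ \text{ on }\mathbb T\times\{t=0\},$$ and let $u$ be the unique viscosity solution of $$u_t+H(u_x)=0\ \text{ in }\mathbb T\times(0,\infty),\qquad u=u_0\ \text{ on }\mathbb T\times\{t=0\}.$$ Then for every $T\in(0,\infty)$ there exists a positive constant $C=C(T)$, independent of $h$, such that for every $h>0$ $$\|u^h(\cdot,t)-u(\cdot,t)\|_{L^1(\mathbb T)}\le Ch\qquad\text{for } t\in[0,T].$$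
   Context: $\mathbb T$ is the one-dimensional torus $\mathbb R/\mathbb Z$, identified with $[0,1]$ when convenient; functions on $\mathbb T$ are regarded as $1$-periodic functions on $\mathbb R$. For $h\in\mathbb R\setminus\{0\}$ and $v:\mathbb T\to\mathbb R$, $\delta_h v(x):=\frac{v(x+h)-v(x)}{h}$, so that $\delta_{-h}v(x)=\frac{v(x)-v(x-h)}{h}$ for $h>0$; difference quotients always act on the space variable $x$. A solution $u^h$ of the semi-discrete problem is a continuous function on $\mathbb T\times[0,\infty)$ with $u^h(x,\cdot)\in C^1([0,\infty))$ for every $x\in\mathbb T$ that satisfies the equation pointwise. The constant $C$ may depend on $H$, $\gamma$, $u_0$ and $T$, but not on $h$. *)

theory Defs
  imports
    "HOL-Analysis.Analysis"
    "HOL-Library.Periodic_Fun"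
    "HOL-Probability.Essential_Supremum"
begin

text \<open>
  Functions on the torus are 1-periodic functions on the reals
  (\<^locale>\<open>periodic_fun_simple'\<close>).  Functions of space and time have type
  \<^typ>\<open>real \<Rightarrow> real \<Rightarrow> real\<close>, with the space variable first; their values at
  negative times are irrelevant.
\<close>

definition smooth :: "(real \<Rightarrow> real) \<Rightarrow> bool" where
  "smooth f \<longleftrightarrow> (\<forall>n. (deriv ^^ n) f differentiable_on UNIV)"

definition coercive :: "(real \<Rightarrow> real) \<Rightarrow> bool" where
  "coercive H \<longleftrightarrow> filterlim H at_top at_infinity"

definition torus_measure :: "real measure" where
  "torus_measure = restrict_space lborel {0..1}"

definition torus_L1_norm :: "(real \<Rightarrow> real) \<Rightarrow> real" where
  "torus_L1_norm f = (LINT x|torus_measure. \<bar>f x\<bar>)"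

definition torus_Linf_norm :: "(real \<Rightarrow> real) \<Rightarrow> ereal" where
  "torus_Linf_norm f = esssup torus_measure (\<lambda>x. ereal \<bar>f x\<bar>)"

definition diff_quot :: "real \<Rightarrow> (real \<Rightarrow> real) \<Rightarrow> real \<Rightarrow> real" where
  "diff_quot h v x = (v (x + h) - v x) / h"

definition num_hamiltonian :: "(real \<Rightarrow> real) \<Rightarrow> real \<Rightarrow> real \<Rightarrow> real \<Rightarrow> real" where
  "num_hamiltonian H \<gamma> p q = H ((q - p) / 2) + \<gamma> * (p + q)"

definition continuous_on_torus_time :: "(real \<Rightarrow> real \<Rightarrow> real) \<Rightarrow> bool" where
  "continuous_on_torus_time v \<longleftrightarrow>
     (\<forall>t\<ge>0. periodic_fun_simple' (\<lambda>x. v x t)) \<and>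
     continuous_on (UNIV \<times> {0..}) (\<lambda>(x, t). v x t)"

text \<open>
  Continuous differentiability on the closed half line, with a one-sided derivative
  at 0 (unlike \<^term>\<open>f C1_differentiable_on {0..}\<close>, which would involve
  negative times).
\<close>

definition C1_half_line :: "(real \<Rightarrow> real) \<Rightarrow> bool" where
  "C1_half_line f \<longleftrightarrow>
     (\<exists>f'. (\<forall>t\<ge>0. (f has_real_derivative f' t) (at t within {0..})) \<and> continuous_on {0..} f')"

definition semidiscrete_solution ::
  "(real \<Rightarrow> real \<Rightarrow> real) \<Rightarrow> (real \<Rightarrow> real) \<Rightarrow> real \<Rightarrow> (real \<Rightarrow> real \<Rightarrow> real) \<Rightarrow> bool" where
  "semidiscrete_solution F u0 h v \<longleftrightarrow>
     continuous_on_torus_time v \<and>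
     (\<forall>x. C1_half_line (v x)) \<and>
     (\<forall>x. \<forall>t>0. deriv (v x) t
        + F (- diff_quot h (\<lambda>y. v y t) x) (diff_quot (- h) (\<lambda>y. v y t) x) = 0) \<and>
     (\<forall>x. v x 0 = u0 x)"

abbreviation space_deriv :: "(real \<Rightarrow> real \<Rightarrow> real) \<Rightarrow> real \<Rightarrow> real \<Rightarrow> real" where
  "space_deriv \<phi> x t \<equiv> deriv (\<lambda>y. \<phi> y t) x"

abbreviation time_deriv :: "(real \<Rightarrow> real \<Rightarrow> real) \<Rightarrow> real \<Rightarrow> real \<Rightarrow> real" where
  "time_deriv \<phi> x t \<equiv> deriv (\<lambda>s. \<phi> x s) t"

text \<open>
  Test functions are \<open>C\<^sup>1\<close> on the torus times the open half line; on this open set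
  it suffices that the partial derivatives exist and are jointly continuous.
\<close>

definition test_function :: "(real \<Rightarrow> real \<Rightarrow> real) \<Rightarrow> bool" where
  "test_function \<phi> \<longleftrightarrow>
     (\<forall>t>0. periodic_fun_simple' (\<lambda>x. \<phi> x t)) \<and>
     (\<forall>x. \<forall>t>0. (\<lambda>y. \<phi> y t) differentiable (at x) \<and> (\<lambda>s. \<phi> x s) differentiable (at t)) \<and>
     continuous_on (UNIV \<times> {0<..}) (\<lambda>(x, t). space_deriv \<phi> x t) \<and>
     continuous_on (UNIV \<times> {0<..}) (\<lambda>(x, t). time_deriv \<phi> x t)"

definition viscosity_subsolution :: "(real \<Rightarrow> real) \<Rightarrow> (real \<Rightarrow> real \<Rightarrow> real) \<Rightarrow> bool" where
  "viscosity_subsolution H u \<longleftrightarrow>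
     (\<forall>\<phi> x t. test_function \<phi> \<and> 0 < t \<and>
        (\<forall>\<^sub>F (y, s) in nhds (x, t). u y s - \<phi> y s \<le> u x t - \<phi> x t) \<longrightarrow>
        time_deriv \<phi> x t + H (space_deriv \<phi> x t) \<le> 0)"

definition viscosity_supersolution :: "(real \<Rightarrow> real) \<Rightarrow> (real \<Rightarrow> real \<Rightarrow> real) \<Rightarrow> bool" where
  "viscosity_supersolution H u \<longleftrightarrow>
     (\<forall>\<phi> x t. test_function \<phi> \<and> 0 < t \<and>
        (\<forall>\<^sub>F (y, s) in nhds (x, t). u y s - \<phi> y s \<ge> u x t - \<phi> x t) \<longrightarrow>
        time_deriv \<phi> x t + H (space_deriv \<phi> x t) \<ge> 0)"

definition viscosity_solution ::
  "(real \<Rightarrow> real) \<Rightarrow> (real \<Rightarrow> real) \<Rightarrow> (real \<Rightarrow> real \<Rightarrow> real) \<Rightarrow> bool" where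
  "viscosity_solution H u0 u \<longleftrightarrow>
     continuous_on_torus_time u \<and>
     viscosity_subsolution H u \<and> viscosity_supersolution H u \<and>
     (\<forall>x. u x 0 = u0 x)"

end

theory Submission
  imports Defs
begin

text \<open>
  Write \<open>Dv\<close> for the central difference of the scheme solution \<open>v\<close>. Pointwise errors of order
  \<open>h\<close> are only available on one side. Let \<open>V\<close> be the Hopf--Lax infimum over \<open>\<bar>p\<bar> \<le> R\<close> of the solutions
  \<open>u0 (x - t H'(p)) + t (p H'(p) - H(p))\<close> of the linearised equations. These are smooth
  uniformly in \<open>p\<close> and, by convexity, supersolutions, so \<open>u \<le> V\<close>, and consistency of the scheme
  gives \<open>v \<le> V + C h\<close>. The average \<open>B\<close> of \<open>V\<close> over a box of size \<open>h\<close> is a \<open>C\<^sup>1\<close> subsolution,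
  so \<open>V - C h \<le> u\<close>. It thus suffices to bound the integral of \<open>B - v\<close> over the torus from above.
  By convexity its time derivative is at most the integral of \<open>- H'(Dv) (B\<^sub>x - Dv)\<close>. As
  \<open>B\<^sub>x\<close> is itself a central difference (of the time average of \<open>V\<close>), summation by parts moves
  the difference operator onto \<open>H'(Dv)\<close>, where the discrete semiconcavity of \<open>v\<close> bounds it from
  above; Gronwall's argument concludes.
\<close>

section \<open>Periodic functions\<close>

lemma periodic_frac:
  fixes f :: "real \<Rightarrow> 'a"
  assumes "\<And>x. f (x + 1) = f x"
  shows "f (frac x) = f x"
proof -
  interpret periodic_fun_simple' f by standard (rule assms)
  show ?thesis unfolding frac_def by (rule minus_of_int)
qed

lemma continuous_on_slice:
  assumes "continuous_on (UNIV \<times> S) (\<lambda>(x, t). f x t)" "t \<in> S"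
  shows "continuous_on A (\<lambda>x. f x t)"
proof -
  have "continuous_on A ((\<lambda>(x, t). f x t) \<circ> (\<lambda>x. (x, t)))"
    by (rule continuous_on_compose)
       (auto intro!: continuous_intros continuous_on_subset[OF assms(1)] simp: assms(2))
  then show ?thesis by (simp add: o_def)
qed

lemma periodic_integral_shift:
  fixes f :: "real \<Rightarrow> real"
  assumes cont: "continuous_on UNIV f" and per: "\<And>x. f (x + 1) = f x"
  shows "integral {0..1} (\<lambda>x. f (x + c)) = integral {0..1} f"
proof -
  interpret periodic_fun_simple' f by standard (rule per)
  define d where "d = frac c"
  have d: "0 \<le> d" "d < 1" by (auto simp: d_def frac_lt_1)
  have int: "f integrable_on {a..b}" for a b
    by (intro integrable_continuous_real continuous_on_subset[OF cont]) auto
  have "f (x + c) = f (x + d)" for x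
    using plus_of_int[of "x + d" "\<lfloor>c\<rfloor>"] by (simp add: d_def frac_def)
  then have "integral {0..1} (\<lambda>x. f (x + c)) = integral {0..1} (\<lambda>x. f (x + d))" by simp
  also have "\<dots> = integral {d..1 + d} f"
    using integral_shift_real_ivl[of d d "1 + d" f] by simp
  also have "\<dots> = integral {d..1} f + integral {1..1 + d} f"
    by (rule Henstock_Kurzweil_Integration.integral_combine[symmetric]) (use d int in auto)
  also have "integral {1..1 + d} f = integral {0..d} f"
    using integral_shift_real_ivl[of 1 1 "1 + d" f] by (simp add: per)
  also have "integral {d..1} f + integral {0..d} f = integral {0..1} f"
    using Henstock_Kurzweil_Integration.integral_combine[of 0 d 1 f] d int by simp
  finally show ?thesis .
qed

lemma periodic_slab_bounded:
  fixes f :: "real \<Rightarrow> real \<Rightarrow> real"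
  assumes cont: "continuous_on (UNIV \<times> {0..}) (\<lambda>(x, t). f x t)"
    and per: "\<And>x t. 0 \<le> t \<Longrightarrow> f (x + 1) t = f x t"
  shows "\<exists>B>0. \<forall>x. \<forall>t\<in>{0..T}. \<bar>f x t\<bar> \<le> B"
proof -
  have "compact ((\<lambda>(x, t). f x t) ` ({0..1} \<times> {0..T}))"
    by (intro compact_continuous_image continuous_on_subset[OF cont] compact_Times) auto
  then obtain B where B: "B > 0" "\<And>y. y \<in> (\<lambda>(x, t). f x t) ` ({0..1} \<times> {0..T}) \<Longrightarrow> norm y \<le> B"
    using compact_imp_bounded bounded_pos by metis
  have "\<bar>f x t\<bar> \<le> B" if "t \<in> {0..T}" for x t
  proof -
    have "f (frac x) t = f x t"
      using per that by (intro periodic_frac[of "\<lambda>x. f x t"]) auto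
    moreover have "\<bar>f (frac x) t\<bar> \<le> B"
      using B(2)[of "f (frac x) t"] that by (force simp: frac_lt_1 less_imp_le)
    ultimately show ?thesis by simp
  qed
  then show ?thesis using B(1) by blast
qed

section \<open>A maximum principle on the periodic strip\<close>

lemma periodic_max_principle:
  fixes w :: "real \<Rightarrow> real \<Rightarrow> real"
  assumes cont: "continuous_on (UNIV \<times> {0..}) (\<lambda>(x, t). w x t)"
    and per: "\<And>x t. 0 \<le> t \<Longrightarrow> w (x + 1) t = w x t"
    and init: "\<And>x. w x 0 \<le> 0"
    and no_max: "\<And>a l x t. \<lbrakk>0 < a; 0 < l; 0 < t; t < T; 0 < w x t; \<And>y. w y t \<le> w x t;
        \<forall>\<^sub>F (y, s) in nhds (x, t). w y s - a * exp (l * s) \<le> w x t - a * exp (l * t)\<rbrakk> \<Longrightarrow> False"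
    and t: "0 \<le> t" "t < T"
  shows "w x t \<le> 0"
proof (rule ccontr)
  assume "\<not> w x t \<le> 0"
  define m where "m = w x t"
  have m: "m > 0" using \<open>\<not> w x t \<le> 0\<close> by (simp add: m_def)
  obtain B where B: "B > 0" "\<And>y s. s \<in> {0..T} \<Longrightarrow> \<bar>w y s\<bar> \<le> B"
    using periodic_slab_bounded[OF cont per, of T] by blast
  define l where "l = 2 * B / (m * (T - t))"
  define a where "a = (m / 2) * exp (- l * t)"
  have l: "l > 0" using B m t by (simp add: l_def)
  have a: "a > 0" using m by (simp add: a_def)
  define k where "k = (\<lambda>s. a * exp (l * s))"
  have k_t: "k t = m / 2" by (simp add: k_def a_def flip: exp_add)
  have "k T = (m / 2) * exp (l * (T - t))"
    by (simp add: k_def a_def right_diff_distrib flip: exp_add)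
  moreover have "l * (T - t) = 2 * B / m" using m t by (simp add: l_def)
  moreover have "exp (2 * B / m) \<ge> 1 + 2 * B / m" by (rule exp_ge_add_one_self)
  ultimately have "k T \<ge> (m / 2) * (1 + 2 * B / m)"
    using m by (simp add: mult_left_mono)
  moreover have "(m / 2) * (1 + 2 * B / m) = m / 2 + B" using m by (simp add: field_simps)
  ultimately have k_T: "k T > B" using m by linarith
  have contk: "continuous_on ({0..1} \<times> {0..T}) (\<lambda>p. (case p of (y, s) \<Rightarrow> w y s) - k (snd p))"
    unfolding k_def by (intro continuous_intros continuous_on_subset[OF cont]) auto
  obtain p where p: "p \<in> {0..1} \<times> {0..T}"
    and pmax: "\<And>q. q \<in> {0..1} \<times> {0..T} \<Longrightarrow>
      (case q of (y, s) \<Rightarrow> w y s) - k (snd q) \<le> (case p of (y, s) \<Rightarrow> w y s) - k (snd p)"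
    using continuous_attains_sup[OF compact_Times _ contk] t by fastforce
  obtain x0 t0 where pq: "p = (x0, t0)" by (cases p)
  have t0: "0 \<le> t0" "t0 \<le> T" using p pq by auto
  have max: "w y s - k s \<le> w x0 t0 - k t0" if "s \<in> {0..T}" for y s
  proof -
    have "w (frac y) s = w y s"
      using per that by (intro periodic_frac[of "\<lambda>x. w x s"]) auto
    then show ?thesis
      using pmax[of "(frac y, s)"] that by (auto simp: pq frac_lt_1 less_imp_le)
  qed
  have pos: "w x0 t0 - k t0 > 0"
    using max[of t x] t k_t m by (simp add: m_def)
  have kpos: "k s > 0" for s using a by (simp add: k_def)
  have "t0 \<noteq> 0" using pos init[of x0] kpos[of t0] by auto
  moreover have "t0 \<noteq> T" using pos k_T B(2)[of T x0] t by (auto simp: abs_le_iff)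
  ultimately have t0': "0 < t0" "t0 < T" using t0 by auto
  have "open (UNIV \<times> {0<..<T} :: (real \<times> real) set)" by (intro open_Times) auto
  then have "\<forall>\<^sub>F q in nhds (x0, t0). q \<in> UNIV \<times> {0<..<T}"
    using t0' by (intro eventually_nhds_in_open) auto
  then have "\<forall>\<^sub>F (y, s) in nhds (x0, t0). w y s - a * exp (l * s) \<le> w x0 t0 - a * exp (l * t0)"
    by eventually_elim (use max in \<open>auto simp: k_def\<close>)
  moreover have "w y t0 \<le> w x0 t0" for y using max[of t0 y] t0 by simp
  moreover have "w x0 t0 > 0" using pos kpos[of t0] by linarith
  ultimately show False using no_max[OF a l t0'] by blast
qed

text \<open>
  The comparison function \<open>g\<close> makes the principle applicable to functions such as
  \<open>\<bar>d\<bar>\<close> that need not be differentiable in time.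
\<close>

lemma periodic_max_principle_deriv:
  fixes w :: "real \<Rightarrow> real \<Rightarrow> real"
  assumes cont: "continuous_on (UNIV \<times> {0..}) (\<lambda>(x, t). w x t)"
    and per: "\<And>x t. 0 \<le> t \<Longrightarrow> w (x + 1) t = w x t"
    and init: "\<And>x. w x 0 \<le> 0"
    and deriv: "\<And>x t. \<lbrakk>0 < t; t < T; 0 < w x t; \<And>y. w y t \<le> w x t\<rbrakk> \<Longrightarrow>
        \<exists>g D. (\<forall>s. g s \<le> w x s) \<and> g t = w x t \<and> (g has_real_derivative D) (at t) \<and> D \<le> 0"
    and t: "0 \<le> t" "t < T"
  shows "w x t \<le> 0"
proof (rule periodic_max_principle[OF cont per init _ t])
  fix a l x t :: real
  assume a: "0 < a" and l: "0 < l" and t: "0 < t" "t < T" "0 < w x t" and m: "\<And>y. w y t \<le> w x t"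
    and ev: "\<forall>\<^sub>F (y, s) in nhds (x, t). w y s - a * exp (l * s) \<le> w x t - a * exp (l * t)"
  obtain g D where g: "\<And>s. g s \<le> w x s" "g t = w x t" "(g has_real_derivative D) (at t)" "D \<le> 0"
    using deriv[OF t m] by blast
  have der: "((\<lambda>s. g s - a * exp (l * s)) has_real_derivative D - a * (exp (l * t) * l)) (at t)"
    by (auto intro!: derivative_eq_intros g(3))
  have "filterlim (\<lambda>s. (x, s)) (nhds (x, t)) (nhds t)"
    unfolding nhds_prod by (intro filterlim_Pair) (auto simp: filterlim_ident)
  from eventually_compose_filterlim[OF ev this]
  have "\<forall>\<^sub>F s in nhds t. w x s - a * exp (l * s) \<le> w x t - a * exp (l * t)" by simp
  then have "\<forall>\<^sub>F s in nhds t. g s - a * exp (l * s) \<le> g t - a * exp (l * t)"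
    by eventually_elim (use g in \<open>smt (verit)\<close>)
  then obtain d where d: "d > 0" "\<And>s. dist s t < d \<Longrightarrow> g s - a * exp (l * s) \<le> g t - a * exp (l * t)"
    unfolding eventually_nhds_metric by blast
  have "D - a * (exp (l * t) * l) = 0"
    using der d(1) by (rule DERIV_local_max) (use d(2) in \<open>auto simp: dist_real_def\<close>)
  moreover have "a * (exp (l * t) * l) > 0" using a l by simp
  ultimately show False using g(4) by simp
qed auto

section \<open>The monotone scheme\<close>

text \<open>
  \<open>M\<close>, \<open>K\<close> and \<open>L\<close> bound \<open>u0''\<close>, \<open>H''\<close> on \<open>[-R, R]\<close> and the Legendre transform
  \<open>p H'(p) - H(p)\<close> on \<open>[-R, R]\<close>; all error constants are expressed through them.
\<close>

locale hj_problem =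
  fixes H H' u0 u0' :: "real \<Rightarrow> real" and R \<gamma> K L M :: real
  assumes H_deriv: "\<And>p. (H has_real_derivative H' p) (at p)"
    and H_tangent: "\<And>p r. H p + H' p * (r - p) \<le> H r"
    and H'_cont: "continuous_on UNIV H'"
    and H'_bound: "\<And>p. \<bar>p\<bar> \<le> R \<Longrightarrow> \<bar>H' p\<bar> \<le> 2 * \<gamma>"
    and H'_loc_lip: "\<And>B. \<exists>K\<ge>0. \<forall>p q. \<bar>p\<bar> \<le> B \<longrightarrow> \<bar>q\<bar> \<le> B \<longrightarrow> \<bar>H' p - H' q\<bar> \<le> K * \<bar>p - q\<bar>"
    and H'_lip: "\<And>p q. \<bar>p\<bar> \<le> R \<Longrightarrow> \<bar>q\<bar> \<le> R \<Longrightarrow> \<bar>H' p - H' q\<bar> \<le> K * \<bar>p - q\<bar>"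
    and legendre_bound: "\<And>p. \<bar>p\<bar> \<le> R \<Longrightarrow> \<bar>p * H' p - H p\<bar> \<le> L"
    and u0_periodic: "\<And>x. u0 (x + 1) = u0 x"
    and u0_deriv: "\<And>x. (u0 has_real_derivative u0' x) (at x)"
    and u0'_bound: "\<And>x. \<bar>u0' x\<bar> \<le> R"
    and u0'_lip: "\<And>x y. \<bar>u0' x - u0' y\<bar> \<le> M * \<bar>x - y\<bar>"
    and R_pos: "0 < R" and gamma_pos: "0 < \<gamma>"
    and K_nonneg: "0 \<le> K" and L_nonneg: "0 \<le> L" and M_nonneg: "0 \<le> M"
begin

lemma H_cont: "continuous_on A H"
  using H_deriv by (meson DERIV_isCont continuous_at_imp_continuous_on)

lemma H'_mono: "p \<le> q \<Longrightarrow> H' p \<le> H' q"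
proof -
  assume "p \<le> q"
  have "(H' q - H' p) * (q - p) \<ge> 0"
    using H_tangent[of p q] H_tangent[of q p] by (simp add: algebra_simps)
  then show ?thesis using \<open>p \<le> q\<close> by (cases "p = q") (auto simp: zero_le_mult_iff)
qed

lemma u0_cont: "continuous_on A u0"
  using u0_deriv by (meson DERIV_isCont continuous_at_imp_continuous_on)

lemma u0'_cont: "continuous_on A u0'"
proof -
  have "M-lipschitz_on A u0'"
    using u0'_lip M_nonneg by (intro lipschitz_onI) (auto simp: dist_real_def)
  then show ?thesis by (rule lipschitz_on_continuous_on)
qed

lemma u0_mvt:
  assumes "a < b"
  shows "\<exists>z. a < z \<and> z < b \<and> u0 b - u0 a = (b - a) * u0' z"
  using MVT2[OF assms, of u0 u0'] u0_deriv by blast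

lemma u0_lip: "\<bar>u0 x - u0 y\<bar> \<le> R * \<bar>x - y\<bar>"
proof -
  have *: "\<bar>u0 b - u0 a\<bar> \<le> R * \<bar>b - a\<bar>" if ab: "a < b" for a b
  proof -
    obtain z where "u0 b - u0 a = (b - a) * u0' z" using u0_mvt[OF ab] by blast
    then show ?thesis
      using mult_right_mono[OF u0'_bound[of z], of "\<bar>b - a\<bar>"] by (simp add: abs_mult mult.commute)
  qed
  show ?thesis
    using *[of x y] *[of y x] by (cases x y rule: linorder_cases) (auto simp: abs_minus_commute)
qed

lemma u0_second_diff:
  assumes "0 < k"
  shows "u0 (x + k) + u0 (x - k) - 2 * u0 x \<le> 2 * M * k\<^sup>2"
proof -
  obtain z where z: "x < z" "z < x + k" "u0 (x + k) - u0 x = k * u0' z"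
    using u0_mvt[of x "x + k"] assms by auto
  obtain y where y: "x - k < y" "y < x" "u0 x - u0 (x - k) = k * u0' y"
    using u0_mvt[of "x - k" x] assms by auto
  have "u0 (x + k) + u0 (x - k) - 2 * u0 x = k * (u0' z - u0' y)"
    using z(3) y(3) by (simp add: algebra_simps)
  also have "u0' z - u0' y \<le> M * \<bar>z - y\<bar>" using u0'_lip[of z y] by linarith
  also have "\<dots> \<le> M * (2 * k)" using z y M_nonneg by (intro mult_left_mono) auto
  finally show ?thesis using assms by (simp add: power2_eq_square algebra_simps)
qed

lemma u0_central_diff:
  assumes "0 < h"
  shows "\<bar>(u0 (x + h) - u0 (x - h)) / (2 * h) - u0' x\<bar> \<le> M * h"
proof -
  obtain z where z: "x - h < z" "z < x + h" "u0 (x + h) - u0 (x - h) = 2 * h * u0' z"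
    using u0_mvt[of "x - h" "x + h"] assms by auto
  have "\<bar>u0' z - u0' x\<bar> \<le> M * \<bar>z - x\<bar>" by (rule u0'_lip)
  also have "\<dots> \<le> M * h" using z M_nonneg by (intro mult_left_mono) auto
  finally show ?thesis using z(3) assms by simp
qed

text \<open>
  The affine Hamiltonian tangent to \<open>H\<close> at \<open>p\<close> has this solution; by convexity it is a
  supersolution for \<open>H\<close>, and the solution for \<open>H\<close> is the infimum over \<open>p\<close>.
\<close>

definition tangent_sol :: "real \<Rightarrow> real \<Rightarrow> real \<Rightarrow> real" where
  "tangent_sol p x t = u0 (x - t * H' p) + t * (p * H' p - H p)"

lemma tangent_sol_periodic: "tangent_sol p (x + 1) t = tangent_sol p x t"
  using u0_periodic[of "x - t * H' p"] by (simp add: tangent_sol_def algebra_simps)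

lemma tangent_sol_time_deriv:
  "((\<lambda>t. tangent_sol p x t) has_real_derivative
     - H' p * u0' (x - t * H' p) + (p * H' p - H p)) (at t)"
  unfolding tangent_sol_def
  by (auto intro!: derivative_eq_intros DERIV_chain2[OF u0_deriv])

lemma tangent_sol_space_deriv:
  "((\<lambda>x. tangent_sol p x t) has_real_derivative u0' (x - t * H' p)) (at x)"
  unfolding tangent_sol_def
  by (auto intro!: derivative_eq_intros DERIV_chain2[OF u0_deriv])

lemma tangent_sol_cont [continuous_intros]:
  assumes "continuous_on A f" "continuous_on A g" "continuous_on A k"
  shows "continuous_on A (\<lambda>z. tangent_sol (f z) (g z) (k z))"
  unfolding tangent_sol_def
  by (intro continuous_intros continuous_on_compose2[OF u0_cont[of UNIV]]
      continuous_on_compose2[OF H_cont[of UNIV]] continuous_on_compose2[OF H'_cont] assms) auto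

end

text \<open>
  At a maximum \<open>z\<close> with neighbouring values \<open>zp\<close> and \<open>zm\<close>; here \<open>e\<close> measures by how much the
  monotonicity condition \<open>\<bar>a\<bar> \<le> 2 \<gamma>\<close> is violated.
\<close>

lemma scheme_at_max:
  fixes a :: real
  assumes "0 < h" "\<bar>a\<bar> \<le> 2 * \<gamma> + e" "0 \<le> e" "zp \<le> z" "zm \<le> z"
  shows "- a * ((zp - zm) / (2 * h)) + \<gamma> * (zp + zm - 2 * z) / h \<le> e * (2 * z - zp - zm) / (2 * h)"
proof -
  have "0 \<le> (2 * \<gamma> - a + e) * (z - zp)" "0 \<le> (2 * \<gamma> + a + e) * (z - zm)"
    using assms by (auto intro!: mult_nonneg_nonneg)
  then have "- a * (zp - zm) + 2 * \<gamma> * (zp + zm - 2 * z) \<le> e * (2 * z - zp - zm)"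
    by (simp add: algebra_simps)
  then have "(- a * (zp - zm) + 2 * \<gamma> * (zp + zm - 2 * z)) / (2 * h) \<le> e * (2 * z - zp - zm) / (2 * h)"
    using assms(1) by (intro divide_right_mono) auto
  moreover have "- a * ((zp - zm) / (2 * h)) + \<gamma> * (zp + zm - 2 * z) / h
      = (- a * (zp - zm) + 2 * \<gamma> * (zp + zm - 2 * z)) / (2 * h)"
    using assms(1) by (simp add: field_simps)
  ultimately show ?thesis by simp
qed

locale scheme_solution = hj_problem +
  fixes h :: real and v :: "real \<Rightarrow> real \<Rightarrow> real"
  assumes h_pos: "0 < h" and v_sol: "semidiscrete_solution (num_hamiltonian H \<gamma>) u0 h v"
begin

definition Dv :: "real \<Rightarrow> real \<Rightarrow> real" where
  "Dv x t = (v (x + h) t - v (x - h) t) / (2 * h)"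

definition v_t :: "real \<Rightarrow> real \<Rightarrow> real" where
  "v_t x t = - H (Dv x t) + \<gamma> * (v (x + h) t + v (x - h) t - 2 * v x t) / h"

lemma v_init: "v x 0 = u0 x"
  using v_sol by (simp add: semidiscrete_solution_def)

lemma v_periodic: "0 \<le> t \<Longrightarrow> v (x + 1) t = v x t"
  using v_sol periodic_fun_simple'.plus_period
  by (fastforce simp: semidiscrete_solution_def continuous_on_torus_time_def)

lemma v_cont: "continuous_on (UNIV \<times> {0..}) (\<lambda>(x, t). v x t)"
  using v_sol by (simp add: semidiscrete_solution_def continuous_on_torus_time_def)

lemma v_cont' [continuous_intros]:
  assumes "continuous_on A f" "continuous_on A g" "\<And>z. z \<in> A \<Longrightarrow> 0 \<le> g z"
  shows "continuous_on A (\<lambda>z. v (f z) (g z))"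
  using continuous_on_compose2[OF v_cont continuous_on_Pair[OF assms(1,2)]] assms(3) by auto

lemma v_deriv:
  assumes "0 < t"
  shows "((\<lambda>t. v x t) has_real_derivative v_t x t) (at t)"
proof -
  obtain f' where "(v x has_real_derivative f' t) (at t within {0..})"
    using v_sol assms unfolding semidiscrete_solution_def C1_half_line_def
    by (meson less_imp_le)
  then have "(v x has_real_derivative f' t) (at t within {0<..})"
    by (rule DERIV_subset) auto
  then have f': "(v x has_real_derivative f' t) (at t)"
    using at_within_open[of t "{0<..}"] assms by simp
  have "(v x has_real_derivative deriv (v x) t) (at t)"
    unfolding DERIV_imp_deriv[OF f'] by (rule f')
  moreover have "deriv (v x) t = v_t x t"
  proof -
    have "deriv (v x) t + num_hamiltonian H \<gamma> (- diff_quot h (\<lambda>y. v y t) x)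
        (diff_quot (- h) (\<lambda>y. v y t) x) = 0"
      using v_sol assms by (simp add: semidiscrete_solution_def)
    moreover have "(diff_quot (- h) (\<lambda>y. v y t) x - - diff_quot h (\<lambda>y. v y t) x) / 2 = Dv x t"
      using h_pos by (simp add: diff_quot_def Dv_def field_simps)
    moreover have "- diff_quot h (\<lambda>y. v y t) x + diff_quot (- h) (\<lambda>y. v y t) x
        = - ((v (x + h) t + v (x - h) t - 2 * v x t) / h)"
      using h_pos by (simp add: diff_quot_def field_simps)
    ultimately show ?thesis by (simp add: num_hamiltonian_def v_t_def)
  qed
  ultimately show ?thesis by simp
qed

lemma v_slope:
  assumes "0 \<le> t"
  shows "\<bar>v (x + h) t - v x t\<bar> \<le> R * h"
proof -
  define d where "d = (\<lambda>x t. (v (x + h) t - v x t) / h)"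
  have d_per: "d (x + 1) t = d x t" if "0 \<le> t" for x t
    using v_periodic[OF that, of x] v_periodic[OF that, of "x + h"]
    by (simp add: d_def algebra_simps)
  have d_cont: "continuous_on (UNIV \<times> {0..}) (\<lambda>(x, t). d x t)"
    unfolding d_def case_prod_unfold using h_pos by (intro continuous_intros) auto
  obtain B where B: "B > 0" "\<And>x s. s \<in> {0..t + 1} \<Longrightarrow> \<bar>d x s\<bar> \<le> B"
    using periodic_slab_bounded[OF d_cont d_per, of "t + 1"] by blast
  obtain K' where K': "K' \<ge> 0" "\<And>p q. \<bar>p\<bar> \<le> R + B \<Longrightarrow> \<bar>q\<bar> \<le> R + B \<Longrightarrow> \<bar>H' p - H' q\<bar> \<le> K' * \<bar>p - q\<bar>"
    using H'_loc_lip[of "R + B"] by blast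
  define \<Lambda> where "\<Lambda> = 2 * K' * B / h"
  define w where "w = (\<lambda>x s. (\<bar>d x s\<bar> - R) * exp (- \<Lambda> * s))"
  have "w x t \<le> 0"
  proof (rule periodic_max_principle_deriv[where T = "t + 1" and w = w])
    show "continuous_on (UNIV \<times> {0..}) (\<lambda>(x, t). w x t)"
      unfolding w_def d_def case_prod_unfold using h_pos by (intro continuous_intros) auto
    show "w (x + 1) t = w x t" if "0 \<le> t" for x t
      using d_per[OF that] by (simp add: w_def)
    show "w x 0 \<le> 0" for x
      using u0_lip[of "x + h" x] h_pos by (simp add: w_def d_def v_init field_simps)
    fix x s assume s: "0 < s" "s < t + 1" and wpos: "0 < w x s" and wmax: "\<And>y. w y s \<le> w x s"
    define \<sigma> where "\<sigma> = sgn (d x s)"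
    define m where "m = \<bar>d x s\<bar>"
    have m: "m > R" using wpos by (simp add: w_def m_def zero_less_mult_iff)
    have dm: "\<bar>d y s\<bar> \<le> m" for y using wmax[of y] by (simp add: w_def m_def)
    have mB: "m \<le> B" using B(2)[of s x] s by (simp add: m_def)
    have \<sigma>: "\<bar>\<sigma>\<bar> = 1" "\<sigma> * d x s = m"
      using m R_pos by (auto simp: \<sigma>_def m_def sgn_if)
    have \<sigma>d: "\<sigma> * r \<le> \<bar>r\<bar>" "- \<bar>r\<bar> \<le> \<sigma> * r" for r
      using abs_ge_self[of "\<sigma> * r"] abs_ge_minus_self[of "\<sigma> * r"] \<sigma>(1) by (auto simp: abs_mult)
    define g where "g = (\<lambda>r. (\<sigma> * d x r - R) * exp (- \<Lambda> * r))"
    define dt where "dt = (v_t (x + h) s - v_t x s) / h"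
    have dt: "((\<lambda>s. d x s) has_real_derivative dt) (at s)"
      unfolding d_def dt_def using h_pos by (auto intro!: derivative_eq_intros v_deriv s)
    have Dd: "Dv y s = (d y s + d (y - h) s) / 2" for y
      using h_pos by (simp add: Dv_def d_def field_simps)
    have Dm: "\<bar>Dv y s\<bar> \<le> m" for y
      unfolding Dd using dm[of y] dm[of "y - h"] by (simp add: abs_le_iff)
    obtain \<xi> where \<xi>: "\<bar>\<xi>\<bar> \<le> m" "H (Dv (x + h) s) - H (Dv x s) = H' \<xi> * (Dv (x + h) s - Dv x s)"
    proof (cases "Dv (x + h) s" "Dv x s" rule: linorder_cases)
      case less
      then obtain z where "Dv (x + h) s < z" "z < Dv x s" "H (Dv x s) - H (Dv (x + h) s) = (Dv x s - Dv (x + h) s) * H' z"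
        using MVT2[OF less, of H H'] H_deriv by blast
      then show ?thesis using that[of z] Dm[of x] Dm[of "x + h"] by (auto simp: algebra_simps)
    next
      case equal
      then show ?thesis using that[of 0] m R_pos by auto
    next
      case greater
      then obtain z where "Dv x s < z" "z < Dv (x + h) s" "H (Dv (x + h) s) - H (Dv x s) = (Dv (x + h) s - Dv x s) * H' z"
        using MVT2[OF greater, of H H'] H_deriv by blast
      then show ?thesis using that[of z] Dm[of x] Dm[of "x + h"] by (auto simp: algebra_simps)
    qed
    have H'\<xi>: "\<bar>H' \<xi>\<bar> \<le> 2 * \<gamma> + K' * (m - R)"
    proof -
      define \<zeta> where "\<zeta> = max (- R) (min R \<xi>)"
      have \<zeta>: "\<bar>\<zeta>\<bar> \<le> R" "\<bar>\<xi> - \<zeta>\<bar> \<le> m - R" using R_pos \<xi>(1) m by (auto simp: \<zeta>_def)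
      have "\<bar>H' \<xi> - H' \<zeta>\<bar> \<le> K' * \<bar>\<xi> - \<zeta>\<bar>"
        using \<zeta> \<xi>(1) mB R_pos B(1) by (intro K'(2)) auto
      also have "\<dots> \<le> K' * (m - R)" using \<zeta> K'(1) by (intro mult_left_mono) auto
      finally show ?thesis using H'_bound[OF \<zeta>(1)] by linarith
    qed
    have dt_eq: "dt = (- H' \<xi> * ((d (x + h) s - d (x - h) s) / 2)
        + \<gamma> * (d (x + h) s + d (x - h) s - 2 * d x s)) / h"
    proof -
      have "v_t (x + h) s - v_t x s = - (H (Dv (x + h) s) - H (Dv x s))
          + \<gamma> * (d (x + h) s + d (x - h) s - 2 * d x s)"
        using h_pos by (simp add: v_t_def d_def field_simps)
      moreover have "Dv (x + h) s - Dv x s = (d (x + h) s - d (x - h) s) / 2"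
        unfolding Dd by (simp add: field_simps)
      ultimately show ?thesis unfolding dt_def \<xi>(2) by simp
    qed
    have "\<sigma> * dt = - H' \<xi> * ((\<sigma> * d (x + h) s - \<sigma> * d (x - h) s) / (2 * h))
        + \<gamma> * (\<sigma> * d (x + h) s + \<sigma> * d (x - h) s - 2 * m) / h"
      unfolding dt_eq \<sigma>(2)[symmetric] using h_pos by (simp add: field_simps)
    also have "\<dots> \<le> K' * (m - R) * (2 * m - \<sigma> * d (x + h) s - \<sigma> * d (x - h) s) / (2 * h)"
      using m K'(1) h_pos H'\<xi> \<sigma>d(1)[of "d (x + h) s"] \<sigma>d(1)[of "d (x - h) s"] dm[of "x + h"] dm[of "x - h"]
      by (intro scheme_at_max) auto
    also have "\<dots> \<le> K' * (m - R) * (4 * B) / (2 * h)"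
      using m K'(1) h_pos \<sigma>d(2)[of "d (x + h) s"] \<sigma>d(2)[of "d (x - h) s"] dm[of "x + h"] dm[of "x - h"] mB
      by (intro divide_right_mono mult_left_mono) auto
    also have "\<dots> = \<Lambda> * (m - R)" using h_pos by (simp add: \<Lambda>_def field_simps)
    finally have \<sigma>dt: "\<sigma> * dt \<le> \<Lambda> * (m - R)" .
    have "(g has_real_derivative (\<sigma> * dt - \<Lambda> * (m - R)) * exp (- \<Lambda> * s)) (at s)"
      unfolding g_def
      by (auto intro!: derivative_eq_intros dt simp: \<sigma>(2) algebra_simps)
    moreover have "(\<sigma> * dt - \<Lambda> * (m - R)) * exp (- \<Lambda> * s) \<le> 0"
      using \<sigma>dt by (intro mult_nonpos_nonneg) auto
    moreover have "g r \<le> w x r" for r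
      using \<sigma>d(1)[of "d x r"] by (simp add: g_def w_def)
    moreover have "g s = w x s" by (simp add: g_def w_def \<sigma>(2) m_def)
    ultimately show "\<exists>g D. (\<forall>r. g r \<le> w x r) \<and> g s = w x s \<and> (g has_real_derivative D) (at s) \<and> D \<le> 0"
      by blast
  qed (use assms in auto)
  then show ?thesis using h_pos by (simp add: w_def d_def mult_le_0_iff field_simps)
qed

lemma Dv_bound:
  assumes "0 \<le> t"
  shows "\<bar>Dv x t\<bar> \<le> R"
proof -
  have "\<bar>v (x + h) t - v (x - h) t\<bar> \<le> R * (2 * h)"
    using v_slope[OF assms, of x] v_slope[OF assms, of "x - h"] by (simp add: algebra_simps)
  then show ?thesis using h_pos by (simp add: Dv_def field_simps)
qed

lemma v_semiconcave:
  assumes "0 \<le> t"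
  shows "v (x + 2 * h) t + v (x - 2 * h) t - 2 * v x t \<le> 8 * M * h\<^sup>2"
proof -
  define w where "w = (\<lambda>x t. v (x + 2 * h) t + v (x - 2 * h) t - 2 * v x t - 8 * M * h\<^sup>2)"
  have "w x t \<le> 0"
  proof (rule periodic_max_principle_deriv[where T = "t + 1" and w = w])
    show "continuous_on (UNIV \<times> {0..}) (\<lambda>(x, t). w x t)"
      unfolding w_def case_prod_unfold using h_pos by (intro continuous_intros) auto
    show "w (x + 1) t = w x t" if "0 \<le> t" for x t
      using v_periodic[OF that, of x] v_periodic[OF that, of "x + 2 * h"] v_periodic[OF that, of "x - 2 * h"]
      by (simp add: w_def algebra_simps)
    show "w x 0 \<le> 0" for x
      using u0_second_diff[of "2 * h" x] h_pos by (simp add: w_def v_init power2_eq_square)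
    fix x s assume s: "0 < s" "s < t + 1" and wmax: "\<And>y. w y s \<le> w x s"
    let ?D = "v_t (x + 2 * h) s + v_t (x - 2 * h) s - 2 * v_t x s"
    have "((\<lambda>s. w x s) has_real_derivative ?D) (at s)"
      unfolding w_def by (auto intro!: derivative_eq_intros v_deriv s)
    moreover have "?D \<le> 0"
    proof -
      let ?a = "H' (Dv x s)"
      define S where "S = (\<lambda>y. \<gamma> * (v (y + h) s + v (y - h) s - 2 * v y s) / h)"
      have v_t_S: "v_t y s = - H (Dv y s) + S y" for y
        by (simp add: v_t_def S_def)
      have S: "\<gamma> * (w (x + h) s + w (x - h) s - 2 * w x s) / h = S (x + 2 * h) + S (x - 2 * h) - 2 * S x"
        using h_pos by (simp add: S_def w_def field_simps)
      have "H (Dv x s) + ?a * (Dv (x + 2 * h) s - Dv x s) + (H (Dv x s) + ?a * (Dv (x - 2 * h) s - Dv x s))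
          \<le> H (Dv (x + 2 * h) s) + H (Dv (x - 2 * h) s)"
        by (intro add_mono H_tangent)
      then have "?D \<le> - ?a * (Dv (x + 2 * h) s + Dv (x - 2 * h) s - 2 * Dv x s)
          + \<gamma> * (w (x + h) s + w (x - h) s - 2 * w x s) / h"
        unfolding v_t_S S by (simp add: algebra_simps)
      also have "Dv (x + 2 * h) s + Dv (x - 2 * h) s - 2 * Dv x s = (w (x + h) s - w (x - h) s) / (2 * h)"
        using h_pos by (simp add: Dv_def w_def field_simps)
      also have "- ?a * ((w (x + h) s - w (x - h) s) / (2 * h))
          + \<gamma> * (w (x + h) s + w (x - h) s - 2 * w x s) / h
          \<le> 0 * (2 * w x s - w (x + h) s - w (x - h) s) / (2 * h)"
        using Dv_bound[of s x] s h_pos wmax H'_bound by (intro scheme_at_max) auto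
      finally show ?thesis by simp
    qed
    ultimately show "\<exists>g D. (\<forall>r. g r \<le> w x r) \<and> g s = w x s \<and> (g has_real_derivative D) (at s) \<and> D \<le> 0"
      by (intro exI[of _ "w x"] exI[of _ ?D]) auto
  qed (use assms in auto)
  then show ?thesis by (simp add: w_def)
qed

lemma v_le_tangent_sol:
  assumes "0 \<le> t" "\<bar>p\<bar> \<le> R"
  shows "v x t \<le> tangent_sol p x t + 4 * \<gamma> * M * h * t"
proof -
  let ?\<phi> = "tangent_sol p"
  define w where "w = (\<lambda>x t. v x t - ?\<phi> x t - 4 * \<gamma> * M * h * t)"
  have "w x t \<le> 0"
  proof (rule periodic_max_principle_deriv[where T = "t + 1" and w = w])
    show "continuous_on (UNIV \<times> {0..}) (\<lambda>(x, t). w x t)"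
      unfolding w_def case_prod_unfold by (intro continuous_intros) auto
    show "w (x + 1) t = w x t" if "0 \<le> t" for x t
      using v_periodic[OF that, of x] tangent_sol_periodic[of p x t] by (simp add: w_def)
    show "w x 0 \<le> 0" for x
      by (simp add: w_def v_init tangent_sol_def)
    fix x s assume s: "0 < s" "s < t + 1" and wmax: "\<And>y. w y s \<le> w x s"
    let ?y = "x - s * H' p" and ?l = "p * H' p - H p"
    let ?D = "v_t x s - (- H' p * u0' ?y + ?l) - 4 * \<gamma> * M * h"
    have "((\<lambda>s. w x s) has_real_derivative ?D) (at s)"
      unfolding w_def by (auto intro!: derivative_eq_intros v_deriv s tangent_sol_time_deriv)
    moreover have "?D \<le> 0"
    proof -
      define c where "c = (u0 (?y + h) - u0 (?y - h)) / (2 * h)"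
      define U where "U = \<gamma> * (u0 (?y + h) + u0 (?y - h) - 2 * u0 ?y) / h"
      define S where "S = \<gamma> * (v (x + h) s + v (x - h) s - 2 * v x s) / h"
      have w1: "(w (x + h) s - w (x - h) s) / (2 * h) = Dv x s - c"
        using h_pos by (simp add: w_def Dv_def c_def tangent_sol_def field_simps)
      have w2: "\<gamma> * (w (x + h) s + w (x - h) s - 2 * w x s) / h = S - U"
        using h_pos by (simp add: w_def S_def U_def tangent_sol_def field_simps)
      have v_t: "v_t x s = - H (Dv x s) + S" by (simp add: v_t_def S_def)
      have "- H (Dv x s) \<le> ?l - H' p * Dv x s"
        using H_tangent[of p "Dv x s"] by (simp add: algebra_simps)
      then have "?D \<le> (- H' p * ((w (x + h) s - w (x - h) s) / (2 * h))
          + \<gamma> * (w (x + h) s + w (x - h) s - 2 * w x s) / h)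
          + H' p * (u0' ?y - c) + U - 4 * \<gamma> * M * h"
        unfolding w1 w2 v_t by (simp add: algebra_simps)
      also have "- H' p * ((w (x + h) s - w (x - h) s) / (2 * h))
          + \<gamma> * (w (x + h) s + w (x - h) s - 2 * w x s) / h
          \<le> 0 * (2 * w x s - w (x + h) s - w (x - h) s) / (2 * h)"
        using h_pos wmax H'_bound[OF assms(2)] by (intro scheme_at_max) auto
      also have "H' p * (u0' ?y - c) \<le> (2 * \<gamma>) * (M * h)"
      proof -
        have "H' p * (u0' ?y - c) \<le> \<bar>H' p\<bar> * \<bar>c - u0' ?y\<bar>"
          by (metis abs_ge_self abs_minus_commute abs_mult)
        also have "\<dots> \<le> (2 * \<gamma>) * (M * h)"
          using H'_bound[OF assms(2)] u0_central_diff[OF h_pos, of ?y] gamma_pos unfolding c_def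
          by (intro mult_mono) auto
        finally show ?thesis .
      qed
      also have "U \<le> \<gamma> * (2 * M * h\<^sup>2) / h"
        unfolding U_def using u0_second_diff[OF h_pos, of ?y] gamma_pos h_pos
        by (intro divide_right_mono mult_left_mono) auto
      finally show ?thesis using h_pos by (simp add: power2_eq_square)
    qed
    ultimately show "\<exists>g D. (\<forall>r. g r \<le> w x r) \<and> g s = w x s \<and> (g has_real_derivative D) (at s) \<and> D \<le> 0"
      by (intro exI[of _ "w x"] exI[of _ ?D]) auto
  qed (use assms in auto)
  then show ?thesis by (simp add: w_def)
qed

end

section \<open>The Hopf--Lax formula\<close>

context hj_problem
begin

definition hopf_lax :: "real \<Rightarrow> real \<Rightarrow> real" where
  "hopf_lax x t = (INF p\<in>{-R..R}. tangent_sol p x t)"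

lemma hopf_lax_attained:
  "\<exists>p. \<bar>p\<bar> \<le> R \<and> hopf_lax x t = tangent_sol p x t \<and> (\<forall>q. \<bar>q\<bar> \<le> R \<longrightarrow> hopf_lax x t \<le> tangent_sol q x t)"
proof -
  have "continuous_on {-R..R} (\<lambda>p. tangent_sol p x t)"
    by (intro continuous_intros)
  then obtain p where p: "p \<in> {-R..R}" "\<And>q. q \<in> {-R..R} \<Longrightarrow> tangent_sol p x t \<le> tangent_sol q x t"
    using continuous_attains_inf[of "{-R..R}" "\<lambda>p. tangent_sol p x t"] R_pos by auto
  have "hopf_lax x t = tangent_sol p x t"
    unfolding hopf_lax_def using p by (intro cInf_eq_minimum) auto
  then show ?thesis using p by (intro exI[of _ p]) (auto simp: abs_le_iff)
qed

lemma hopf_lax_le: "\<bar>p\<bar> \<le> R \<Longrightarrow> hopf_lax x t \<le> tangent_sol p x t"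
  using hopf_lax_attained by blast

lemma le_hopf_lax: "(\<And>p. \<bar>p\<bar> \<le> R \<Longrightarrow> c \<le> tangent_sol p x t) \<Longrightarrow> c \<le> hopf_lax x t"
  using hopf_lax_attained[of x t] by auto

lemma hopf_lax_init: "hopf_lax x 0 = u0 x"
  using hopf_lax_attained[of x 0] by (auto simp: tangent_sol_def)

lemma hopf_lax_periodic: "hopf_lax (x + 1) t = hopf_lax x t"
  by (simp add: hopf_lax_def tangent_sol_periodic)

definition time_lip :: real where
  "time_lip = 2 * \<gamma> * R + L"

lemma time_lip_nonneg: "0 \<le> time_lip"
  using gamma_pos R_pos L_nonneg by (simp add: time_lip_def)

lemma tangent_sol_lip:
  assumes "\<bar>p\<bar> \<le> R"
  shows "tangent_sol p x t \<le> tangent_sol p y s + R * \<bar>x - y\<bar> + time_lip * \<bar>t - s\<bar>"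
proof -
  have "u0 (x - t * H' p) - u0 (y - s * H' p) \<le> R * \<bar>(x - t * H' p) - (y - s * H' p)\<bar>"
    using u0_lip[of "x - t * H' p" "y - s * H' p"] by linarith
  also have "\<bar>(x - t * H' p) - (y - s * H' p)\<bar> = \<bar>(x - y) - (t - s) * H' p\<bar>"
    by (simp add: algebra_simps)
  also have "\<dots> \<le> \<bar>x - y\<bar> + \<bar>(t - s) * H' p\<bar>" by linarith
  also have "\<bar>(t - s) * H' p\<bar> \<le> \<bar>t - s\<bar> * (2 * \<gamma>)"
    unfolding abs_mult using H'_bound[OF assms] by (intro mult_left_mono) auto
  finally have 1: "u0 (x - t * H' p) - u0 (y - s * H' p) \<le> R * (\<bar>x - y\<bar> + \<bar>t - s\<bar> * (2 * \<gamma>))"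
    using R_pos by simp
  have "(t - s) * (p * H' p - H p) \<le> \<bar>t - s\<bar> * \<bar>p * H' p - H p\<bar>"
    by (metis abs_ge_self abs_mult)
  also have "\<dots> \<le> \<bar>t - s\<bar> * L" using legendre_bound[OF assms] by (intro mult_left_mono) auto
  finally have 2: "t * (p * H' p - H p) - s * (p * H' p - H p) \<le> \<bar>t - s\<bar> * L"
    by (simp add: left_diff_distrib)
  show ?thesis using 1 2 by (simp add: tangent_sol_def time_lip_def algebra_simps)
qed

lemma hopf_lax_lip:
  "hopf_lax x t \<le> hopf_lax y s + R * \<bar>x - y\<bar> + time_lip * \<bar>t - s\<bar>"
proof -
  obtain p where p: "\<bar>p\<bar> \<le> R" "hopf_lax y s = tangent_sol p y s"
    using hopf_lax_attained by blast
  show ?thesis using hopf_lax_le[OF p(1), of x t] tangent_sol_lip[OF p(1), of x t y s] p(2) by linarith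
qed

lemma hopf_lax_cont: "continuous_on UNIV (\<lambda>(x, t). hopf_lax x t)"
proof -
  have "(R + time_lip)-lipschitz_on UNIV (\<lambda>(x, t). hopf_lax x t)"
  proof (rule lipschitz_onI)
    fix a b :: "real \<times> real"
    obtain x t y s where ab: "a = (x, t)" "b = (y, s)" by (cases a, cases b)
    have "\<bar>x - y\<bar> \<le> dist a b" "\<bar>t - s\<bar> \<le> dist a b"
      using dist_fst_le[of a b] dist_snd_le[of a b] by (auto simp: ab dist_real_def)
    then have "R * \<bar>x - y\<bar> + time_lip * \<bar>t - s\<bar> \<le> R * dist a b + time_lip * dist a b"
      using R_pos time_lip_nonneg by (intro add_mono mult_left_mono) auto
    moreover have "\<bar>hopf_lax x t - hopf_lax y s\<bar> \<le> R * \<bar>x - y\<bar> + time_lip * \<bar>t - s\<bar>"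
      using hopf_lax_lip[of x t y s] hopf_lax_lip[of y s x t]
      by (simp add: abs_le_iff abs_minus_commute)
    ultimately show "dist (case a of (x, t) \<Rightarrow> hopf_lax x t) (case b of (x, t) \<Rightarrow> hopf_lax x t)
        \<le> (R + time_lip) * dist a b"
      by (simp add: ab dist_real_def algebra_simps)
  qed (use R_pos time_lip_nonneg in auto)
  then show ?thesis by (rule lipschitz_on_continuous_on)
qed

text \<open>
  The characteristic speeds combine: \<open>r\<close> with \<open>(t + s) H'(r) = t H'(p) + s H'(q)\<close> joins
  the foot of the \<open>p\<close>-characteristic to the end point in a single straight line.
\<close>

lemma hopf_lax_dynamic_programming:
  assumes q: "\<bar>q\<bar> \<le> R" and t: "0 \<le> t" and s: "0 \<le> s"
  shows "hopf_lax (x + s * H' q) (t + s) \<le> hopf_lax x t + s * (q * H' q - H q)"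
proof (cases "t + s = 0")
  case True
  then have "t = 0" "s = 0" using t s by linarith+
  then show ?thesis by simp
next
  case False
  then have ts: "t + s > 0" using t s by simp
  obtain p where p: "\<bar>p\<bar> \<le> R" "hopf_lax x t = tangent_sol p x t"
    using hopf_lax_attained by blast
  define \<theta> where "\<theta> = (t * H' p + s * H' q) / (t + s)"
  have "H' (min p q) \<le> H' p" "H' (min p q) \<le> H' q" "H' p \<le> H' (max p q)" "H' q \<le> H' (max p q)"
    by (auto intro: H'_mono)
  then have "(t + s) * H' (min p q) \<le> t * H' p + s * H' q" "t * H' p + s * H' q \<le> (t + s) * H' (max p q)"
    using t s by (simp_all only: distrib_right add_mono mult_left_mono)
  then have "H' (min p q) \<le> \<theta>" "\<theta> \<le> H' (max p q)"
    using ts by (auto simp: \<theta>_def field_simps)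
  moreover have "min p q \<le> max p q" by simp
  ultimately obtain r where r: "min p q \<le> r" "r \<le> max p q" "H' r = \<theta>"
    using IVT'[of H' "min p q" \<theta> "max p q"] continuous_on_subset[OF H'_cont subset_UNIV] by blast
  have rR: "\<bar>r\<bar> \<le> R" using r p(1) q by (auto simp: abs_le_iff)
  have speed: "(t + s) * H' r = t * H' p + s * H' q" using ts by (simp add: r(3) \<theta>_def)
  have tangent: "r * H' p - H r \<le> p * H' p - H p" for p
    using H_tangent[of p r] by (simp add: algebra_simps)
  have "t * (r * H' p - H r) \<le> t * (p * H' p - H p)" "s * (r * H' q - H r) \<le> s * (q * H' q - H q)"
    using t s by (auto intro: mult_left_mono tangent)
  then have "r * (t * H' p + s * H' q) - (t + s) * H r \<le> t * (p * H' p - H p) + s * (q * H' q - H q)"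
    by (simp add: algebra_simps)
  then have cost: "(t + s) * (r * H' r - H r) \<le> t * (p * H' p - H p) + s * (q * H' q - H q)"
    using arg_cong[OF speed, of "\<lambda>y. r * y"] by (simp add: algebra_simps)
  have "hopf_lax (x + s * H' q) (t + s) \<le> u0 (x + s * H' q - (t + s) * H' r) + (t + s) * (r * H' r - H r)"
    using hopf_lax_le[OF rR] by (simp add: tangent_sol_def)
  also have "x + s * H' q - (t + s) * H' r = x - t * H' p" by (simp add: speed)
  finally show ?thesis using cost by (simp add: p(2) tangent_sol_def)
qed

end

section \<open>Comparison with viscosity solutions\<close>

lemma test_functionI:
  assumes "\<And>x t. 0 < t \<Longrightarrow> \<phi> (x + 1) t = \<phi> x t"
    and x: "\<And>x t. 0 < t \<Longrightarrow> ((\<lambda>y. \<phi> y t) has_real_derivative \<phi>x x t) (at x)"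
    and t: "\<And>x t. 0 < t \<Longrightarrow> ((\<lambda>s. \<phi> x s) has_real_derivative \<phi>t x t) (at t)"
    and cont: "continuous_on (UNIV \<times> {0<..}) (\<lambda>(x, t). \<phi>x x t)" "continuous_on (UNIV \<times> {0<..}) (\<lambda>(x, t). \<phi>t x t)"
  shows "test_function \<phi>"
proof -
  have "continuous_on (UNIV \<times> {0<..}) (\<lambda>(x, t). space_deriv \<phi> x t)"
    by (rule iffD2[OF continuous_on_cong cont(1)]) (auto simp: DERIV_imp_deriv[OF x])
  moreover have "continuous_on (UNIV \<times> {0<..}) (\<lambda>(x, t). time_deriv \<phi> x t)"
    by (rule iffD2[OF continuous_on_cong cont(2)]) (auto simp: DERIV_imp_deriv[OF t])
  ultimately show ?thesis
    unfolding test_function_def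
    using assms(1) x t unfolding periodic_fun_simple'_def real_differentiable_def by blast
qed

context hj_problem
begin

lemma viscosity_solution_le_tangent_sol:
  assumes u: "viscosity_solution H u0 u" and t: "0 \<le> t"
  shows "u x t \<le> tangent_sol p x t"
proof -
  have u_cont: "continuous_on (UNIV \<times> {0..}) (\<lambda>(x, t). u x t)"
    using u by (simp add: viscosity_solution_def continuous_on_torus_time_def)
  have u_per: "u (x + 1) t = u x t" if "0 \<le> t" for x t
    using u that periodic_fun_simple'.plus_period[of "\<lambda>x. u x t"]
    by (auto simp: viscosity_solution_def continuous_on_torus_time_def)
  define w where "w = (\<lambda>x t. u x t - tangent_sol p x t)"
  have "w x t \<le> 0"
  proof (rule periodic_max_principle[where T = "t + 1" and w = w])
    have "continuous_on (UNIV \<times> {0..}) (\<lambda>z. (case z of (x, t) \<Rightarrow> u x t) - tangent_sol p (fst z) (snd z))"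
      by (intro continuous_intros u_cont)
    then show "continuous_on (UNIV \<times> {0..}) (\<lambda>(x, t). w x t)"
      by (simp add: w_def case_prod_unfold)
    show "w (x + 1) t = w x t" if "0 \<le> t" for x t
      using u_per[OF that] by (simp add: w_def tangent_sol_periodic)
    show "w x 0 \<le> 0" for x
      using u by (simp add: w_def viscosity_solution_def tangent_sol_def)
    fix a l x t :: real
    assume a: "0 < a" and l: "0 < l" and t: "0 < t"
      and ev: "\<forall>\<^sub>F (y, s) in nhds (x, t). w y s - a * exp (l * s) \<le> w x t - a * exp (l * t)"
    define \<phi> where "\<phi> = (\<lambda>x t. tangent_sol p x t + a * exp (l * t))"
    define \<phi>x where "\<phi>x = (\<lambda>x t. u0' (x - t * H' p))"
    define \<phi>t where "\<phi>t = (\<lambda>x t. - H' p * u0' (x - t * H' p) + (p * H' p - H p) + a * l * exp (l * t))"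
    have \<phi>x: "((\<lambda>y. \<phi> y t) has_real_derivative \<phi>x x t) (at x)" for x t
      unfolding \<phi>_def \<phi>x_def by (auto intro!: derivative_eq_intros tangent_sol_space_deriv)
    have \<phi>t: "((\<lambda>s. \<phi> x s) has_real_derivative \<phi>t x t) (at t)" for x t
      unfolding \<phi>_def \<phi>t_def by (auto intro!: derivative_eq_intros tangent_sol_time_deriv)
    have "test_function \<phi>"
    proof (rule test_functionI[OF _ \<phi>x \<phi>t])
      show "continuous_on (UNIV \<times> {0<..}) (\<lambda>(x, t). \<phi>x x t)"
        unfolding \<phi>x_def case_prod_unfold
        by (intro continuous_intros continuous_on_compose2[OF u0'_cont[of UNIV]]) auto
      show "continuous_on (UNIV \<times> {0<..}) (\<lambda>(x, t). \<phi>t x t)"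
        unfolding \<phi>t_def case_prod_unfold
        by (intro continuous_intros continuous_on_compose2[OF u0'_cont[of UNIV]]) auto
    qed (simp add: \<phi>_def tangent_sol_periodic)
    moreover have "\<forall>\<^sub>F (y, s) in nhds (x, t). u y s - \<phi> y s \<le> u x t - \<phi> x t"
      using ev by eventually_elim (auto simp: \<phi>_def w_def)
    ultimately have "time_deriv \<phi> x t + H (space_deriv \<phi> x t) \<le> 0"
      using u t unfolding viscosity_solution_def viscosity_subsolution_def by blast
    then have "\<phi>t x t + H (\<phi>x x t) \<le> 0"
      by (simp add: DERIV_imp_deriv[OF \<phi>x] DERIV_imp_deriv[OF \<phi>t])
    moreover have "a * l * exp (l * t) > 0" using a l by simp
    ultimately show False
      using H_tangent[of p "\<phi>x x t"] by (simp add: \<phi>t_def \<phi>x_def algebra_simps)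
  qed (use t in auto)
  then show ?thesis by (simp add: w_def)
qed

lemma viscosity_solution_le_hopf_lax:
  "viscosity_solution H u0 u \<Longrightarrow> 0 \<le> t \<Longrightarrow> u x t \<le> hopf_lax x t"
  by (simp add: le_hopf_lax viscosity_solution_le_tangent_sol)

end

lemma classical_subsolution_le_viscosity_solution:
  assumes u: "viscosity_solution H u0 u"
    and \<psi>_cont: "continuous_on (UNIV \<times> {0..}) (\<lambda>(x, t). \<psi> x t)"
    and \<psi>_per: "\<And>x t. 0 \<le> t \<Longrightarrow> \<psi> (x + 1) t = \<psi> x t"
    and \<psi>x: "\<And>x t. 0 < t \<Longrightarrow> ((\<lambda>y. \<psi> y t) has_real_derivative \<psi>x x t) (at x)"
    and \<psi>t: "\<And>x t. 0 < t \<Longrightarrow> ((\<lambda>s. \<psi> x s) has_real_derivative \<psi>t x t) (at t)"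
    and cont: "continuous_on (UNIV \<times> {0<..}) (\<lambda>(x, t). \<psi>x x t)" "continuous_on (UNIV \<times> {0<..}) (\<lambda>(x, t). \<psi>t x t)"
    and sub: "\<And>x t. 0 < t \<Longrightarrow> \<psi>t x t + H (\<psi>x x t) \<le> 0"
    and init: "\<And>x. \<psi> x 0 \<le> u0 x"
    and t: "0 \<le> t"
  shows "\<psi> x t \<le> u x t"
proof -
  have u_cont: "continuous_on (UNIV \<times> {0..}) (\<lambda>(x, t). u x t)"
    using u by (simp add: viscosity_solution_def continuous_on_torus_time_def)
  have u_per: "u (x + 1) t = u x t" if "0 \<le> t" for x t
    using u that periodic_fun_simple'.plus_period[of "\<lambda>x. u x t"]
    by (auto simp: viscosity_solution_def continuous_on_torus_time_def)
  define w where "w = (\<lambda>x t. \<psi> x t - u x t)"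
  have "w x t \<le> 0"
  proof (rule periodic_max_principle[where T = "t + 1" and w = w])
    show "continuous_on (UNIV \<times> {0..}) (\<lambda>(x, t). w x t)"
      using continuous_on_diff[OF \<psi>_cont u_cont] by (simp add: w_def case_prod_unfold)
    show "w (x + 1) t = w x t" if "0 \<le> t" for x t
      using u_per[OF that] \<psi>_per[OF that] by (simp add: w_def)
    show "w x 0 \<le> 0" for x
      using u init[of x] by (simp add: w_def viscosity_solution_def)
    fix a l x t :: real
    assume a: "0 < a" and l: "0 < l" and t: "0 < t"
      and ev: "\<forall>\<^sub>F (y, s) in nhds (x, t). w y s - a * exp (l * s) \<le> w x t - a * exp (l * t)"
    define \<phi> where "\<phi> = (\<lambda>x t. \<psi> x t - a * exp (l * t))"
    define \<phi>t where "\<phi>t = (\<lambda>x t. \<psi>t x t - a * l * exp (l * t))"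
    have \<phi>x: "((\<lambda>y. \<phi> y t) has_real_derivative \<psi>x x t) (at x)" if "0 < t" for x t
      unfolding \<phi>_def by (auto intro!: derivative_eq_intros \<psi>x that)
    have \<phi>t: "((\<lambda>s. \<phi> x s) has_real_derivative \<phi>t x t) (at t)" if "0 < t" for x t
      unfolding \<phi>_def \<phi>t_def by (auto intro!: derivative_eq_intros \<psi>t that)
    have "test_function \<phi>"
    proof (rule test_functionI[OF _ \<phi>x \<phi>t cont(1)])
      have "continuous_on (UNIV \<times> {0<..}) (\<lambda>z. (case z of (x, t) \<Rightarrow> \<psi>t x t) - a * l * exp (l * snd z) :: real)"
        by (intro continuous_intros cont(2))
      then show "continuous_on (UNIV \<times> {0<..}) (\<lambda>(x, t). \<phi>t x t)"
        by (simp add: \<phi>t_def case_prod_unfold)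
    qed (simp_all add: \<phi>_def \<psi>_per)
    moreover have "\<forall>\<^sub>F (y, s) in nhds (x, t). u y s - \<phi> y s \<ge> u x t - \<phi> x t"
      using ev by eventually_elim (auto simp: \<phi>_def w_def)
    ultimately have "time_deriv \<phi> x t + H (space_deriv \<phi> x t) \<ge> 0"
      using u t unfolding viscosity_solution_def viscosity_supersolution_def by blast
    then have "\<phi>t x t + H (\<psi>x x t) \<ge> 0"
      using DERIV_imp_deriv[OF \<phi>x[OF t]] DERIV_imp_deriv[OF \<phi>t[OF t]] by simp
    moreover have "a * l * exp (l * t) > 0" using a l by simp
    ultimately show False using sub[OF t, of x] by (simp add: \<phi>t_def)
  qed (use t in auto)
  then show ?thesis by (simp add: w_def)
qed

section \<open>Box averages\<close>

lemma continuous_on_compose_pair: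
  assumes "continuous_on UNIV (\<lambda>(x, t). f x t)" "continuous_on A F" "continuous_on A G"
  shows "continuous_on A (\<lambda>z. f (F z) (G z))"
  using continuous_on_compose2[OF assms(1) continuous_on_Pair[OF assms(2,3)]] by auto

lemma moving_integral_deriv:
  fixes g :: "real \<Rightarrow> real"
  assumes g: "continuous_on UNIV g" and "a \<le> b"
  shows "((\<lambda>x. integral {a..b} (\<lambda>s. g (x + s))) has_real_derivative g (x + b) - g (x + a)) (at x)"
proof -
  obtain G where G: "\<And>y. y \<in> {x + a - 1..x + b + 1} \<Longrightarrow>
      (G has_vector_derivative g y) (at y within {x + a - 1..x + b + 1})"
    using antiderivative_continuous[OF continuous_on_subset[OF g]] by (metis UNIV_I subsetI)
  have G': "(G has_real_derivative g y) (at y)" if "x + a - 1 < y" "y < x + b + 1" for y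
    using G[of y] that by (simp add: at_within_Icc_at has_real_derivative_iff_has_vector_derivative)
  have int: "integral {a..b} (\<lambda>s. g (y + s)) = G (y + b) - G (y + a)" if "y \<in> {x - 1<..<x + 1}" for y
  proof -
    have "integral {a..b} (\<lambda>s. g (y + s)) = integral {y + a..y + b} g"
      using integral_shift_real_ivl[of "y + a" y "y + b" g] by (simp add: add.commute)
    also have "(g has_integral (G (y + b) - G (y + a))) {y + a..y + b}"
      using assms(2) that
      by (intro fundamental_theorem_of_calculus has_vector_derivative_within_subset[OF G]) auto
    then have "integral {y + a..y + b} g = G (y + b) - G (y + a)" by (rule integral_unique)
    finally show ?thesis .
  qed
  have "((\<lambda>y. G (y + b) - G (y + a)) has_real_derivative g (x + b) - g (x + a)) (at x)"
    using assms(2) by (auto intro!: derivative_eq_intros DERIV_chain2[OF G'])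
  then show ?thesis
    by (rule has_field_derivative_transform_within_open[of _ _ _ "{x - 1<..<x + 1}"]) (auto simp: int)
qed

lemma average_mono:
  fixes f g :: "real \<Rightarrow> real"
  assumes "continuous_on {a..b} f" "continuous_on {a..b} g" "a < b"
    and le: "\<And>s. s \<in> {a..b} \<Longrightarrow> f s \<le> g s + c"
  shows "integral {a..b} f / (b - a) \<le> integral {a..b} g / (b - a) + c"
proof -
  have "integral {a..b} f \<le> integral {a..b} (\<lambda>s. g s + c)"
    using assms by (intro integral_le integrable_continuous_real continuous_intros) auto
  also have "\<dots> = integral {a..b} g + (b - a) * c"
    using assms by (subst Henstock_Kurzweil_Integration.integral_add)
      (auto intro!: integrable_continuous_real)
  finally have "integral {a..b} f / (b - a) \<le> (integral {a..b} g + (b - a) * c) / (b - a)"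
    using assms(3) by (intro divide_right_mono) auto
  then show ?thesis using assms(3) by (simp add: add_divide_distrib)
qed

lemma average_close:
  fixes f :: "real \<Rightarrow> real"
  assumes "continuous_on {a..b} f" "a < b" "\<And>s. s \<in> {a..b} \<Longrightarrow> \<bar>f s - c\<bar> \<le> e"
  shows "\<bar>integral {a..b} f / (b - a) - c\<bar> \<le> e"
proof -
  have "integral {a..b} f / (b - a) \<le> integral {a..b} (\<lambda>_. c) / (b - a) + e"
  proof (rule average_mono)
    show "f s \<le> c + e" if "s \<in> {a..b}" for s using assms(3)[OF that] by linarith
  qed (use assms in auto)
  moreover have "integral {a..b} (\<lambda>_. c) / (b - a) \<le> integral {a..b} f / (b - a) + e"
  proof (rule average_mono)
    show "c \<le> f s + e" if "s \<in> {a..b}" for s using assms(3)[OF that] by linarith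
  qed (use assms in auto)
  ultimately show ?thesis using assms(2) by (simp add: abs_le_iff)
qed

definition time_avg :: "real \<Rightarrow> (real \<Rightarrow> real \<Rightarrow> real) \<Rightarrow> real \<Rightarrow> real \<Rightarrow> real" where
  "time_avg h f x t = integral {0..h} (\<lambda>s. f x (t + s)) / h"

definition box_avg :: "real \<Rightarrow> (real \<Rightarrow> real \<Rightarrow> real) \<Rightarrow> real \<Rightarrow> real \<Rightarrow> real" where
  "box_avg h f x t = integral {-h..h} (\<lambda>s. time_avg h f (x + s) t) / (2 * h)"

definition box_avg_x :: "real \<Rightarrow> (real \<Rightarrow> real \<Rightarrow> real) \<Rightarrow> real \<Rightarrow> real \<Rightarrow> real" where
  "box_avg_x h f x t = (time_avg h f (x + h) t - time_avg h f (x - h) t) / (2 * h)"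

definition box_avg_t :: "real \<Rightarrow> (real \<Rightarrow> real \<Rightarrow> real) \<Rightarrow> real \<Rightarrow> real \<Rightarrow> real" where
  "box_avg_t h f x t = integral {-h..h} (\<lambda>s. (f (x + s) (t + h) - f (x + s) t) / h) / (2 * h)"

context
  fixes f :: "real \<Rightarrow> real \<Rightarrow> real" and h :: real
  assumes f_cont: "continuous_on UNIV (\<lambda>(x, t). f x t)" and h: "0 < h"
begin

lemmas f_cont' = continuous_on_compose_pair[OF f_cont]

lemma integral_param_cont:
  assumes "continuous_on UNIV (\<lambda>((x, t), s). g x t s :: real)"
  shows "continuous_on UNIV (\<lambda>(x, t). integral {a..b::real} (g x t))"
proof -
  have "continuous_on UNIV (\<lambda>z. integral (cbox a b) (case z of (x, t) \<Rightarrow> g x t))"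
    by (rule integral_continuous_on_param)
       (use continuous_on_subset[OF assms] in \<open>auto simp: case_prod_unfold\<close>)
  then show ?thesis by (simp add: case_prod_unfold)
qed

lemma time_avg_cont: "continuous_on UNIV (\<lambda>(x, t). time_avg h f x t)"
proof -
  have "continuous_on UNIV (\<lambda>(x, t). integral {0..h} (\<lambda>s. f x (t + s)))"
    by (rule integral_param_cont) (unfold case_prod_unfold, intro continuous_intros f_cont')
  then have "continuous_on UNIV (\<lambda>z. (case z of (x, t) \<Rightarrow> integral {0..h} (\<lambda>s. f x (t + s))) / h)"
    using h by (intro continuous_intros) auto
  then show ?thesis by (simp add: time_avg_def case_prod_unfold)
qed

lemmas time_avg_cont' = continuous_on_compose_pair[OF time_avg_cont]

lemma box_avg_cont: "continuous_on UNIV (\<lambda>(x, t). box_avg h f x t)"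
proof -
  have "continuous_on UNIV (\<lambda>(x, t). integral {-h..h} (\<lambda>s. time_avg h f (x + s) t))"
    by (rule integral_param_cont) (unfold case_prod_unfold, intro continuous_intros time_avg_cont')
  then have "continuous_on UNIV (\<lambda>z. (case z of (x, t) \<Rightarrow> integral {-h..h} (\<lambda>s. time_avg h f (x + s) t)) / (2 * h))"
    using h by (intro continuous_intros) auto
  then show ?thesis by (simp add: box_avg_def case_prod_unfold)
qed

lemma box_avg_x_cont: "continuous_on UNIV (\<lambda>(x, t). box_avg_x h f x t)"
  unfolding box_avg_x_def case_prod_unfold using h
  by (intro continuous_intros time_avg_cont') auto

lemma box_avg_t_cont: "continuous_on UNIV (\<lambda>(x, t). box_avg_t h f x t)"
proof -
  have "continuous_on UNIV (\<lambda>(x, t). integral {-h..h} (\<lambda>s. (f (x + s) (t + h) - f (x + s) t) / h))"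
    by (rule integral_param_cont)
       (unfold case_prod_unfold, intro continuous_intros f_cont', use h in auto)
  then have "continuous_on UNIV (\<lambda>z. (case z of (x, t) \<Rightarrow>
      integral {-h..h} (\<lambda>s. (f (x + s) (t + h) - f (x + s) t) / h)) / (2 * h))"
    using h by (intro continuous_intros) auto
  then show ?thesis by (simp add: box_avg_t_def case_prod_unfold)
qed

lemma time_avg_deriv: "((\<lambda>t. time_avg h f x t) has_real_derivative (f x (t + h) - f x t) / h) (at t)"
proof -
  have "continuous_on UNIV (f x)"
    using f_cont'[of UNIV "\<lambda>_. x" "\<lambda>t. t"] by simp
  from moving_integral_deriv[OF this, of 0 h t] h show ?thesis
    unfolding time_avg_def by (auto intro!: derivative_eq_intros)
qed

lemma box_avg_deriv_x: "((\<lambda>x. box_avg h f x t) has_real_derivative box_avg_x h f x t) (at x)"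
proof -
  have "continuous_on UNIV (\<lambda>x. time_avg h f x t)" by (intro time_avg_cont' continuous_intros)
  from DERIV_cdivide[OF moving_integral_deriv[OF this, of "-h" h x], of "2 * h"] h show ?thesis
    by (simp add: box_avg_def box_avg_x_def)
qed

lemma box_avg_deriv_t: "((\<lambda>t. box_avg h f x t) has_real_derivative box_avg_t h f x t) (at t)"
proof -
  have "((\<lambda>t. integral (cbox (-h) h) (\<lambda>s. time_avg h f (x + s) t)) has_field_derivative
      integral (cbox (-h) h) (\<lambda>s. (f (x + s) (t + h) - f (x + s) t) / h)) (at t within UNIV)"
  proof (rule leibniz_rule_field_derivative)
    show "continuous_on (UNIV \<times> cbox (-h) h) (\<lambda>(t, s). (f (x + s) (t + h) - f (x + s) t) / h)"
      unfolding case_prod_unfold using h by (intro continuous_intros f_cont') auto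
    show "(\<lambda>s. time_avg h f (x + s) t) integrable_on cbox (-h) h" for t
      by (intro integrable_continuous time_avg_cont' continuous_intros)
  qed (auto intro: time_avg_deriv)
  then show ?thesis
    unfolding box_avg_def box_avg_t_def using h by (auto intro!: derivative_eq_intros)
qed

lemma box_avg_line_deriv:
  "((\<lambda>s. box_avg h f (x + s * c) (t + s)) has_real_derivative box_avg_x h f x t * c + box_avg_t h f x t) (at 0)"
proof -
  have "((\<lambda>(x, t). box_avg h f x t) has_derivative
      (\<lambda>(tx, ty). box_avg_x h f x t * tx + blinfun_scaleR_left (box_avg_t h f x t) ty)) (at (x, t) within UNIV \<times> UNIV)"
  proof (rule has_derivative_partialsI)
    show "((\<lambda>x. box_avg h f x t) has_derivative (\<lambda>tx. box_avg_x h f x t * tx)) (at x within UNIV)"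
      using box_avg_deriv_x by (simp add: has_field_derivative_def)
    show "((\<lambda>t. box_avg h f x t) has_derivative blinfun_apply (blinfun_scaleR_left (box_avg_t h f x t))) (at t within UNIV)" for x t
      using box_avg_deriv_t[of x t]
      by (simp add: has_field_derivative_def mult_commute_abs)
    have "continuous_on UNIV (\<lambda>z. blinfun_scaleR_left (case z of (x, t) \<Rightarrow> box_avg_t h f x t) :: real \<Rightarrow>\<^sub>L real)"
      by (intro bounded_linear.continuous_on[OF bounded_linear_blinfun_scaleR_left] box_avg_t_cont)
    then show "continuous (at (x, t) within UNIV \<times> UNIV) (\<lambda>(x, t). blinfun_scaleR_left (box_avg_t h f x t) :: real \<Rightarrow>\<^sub>L real)"
      by (simp add: continuous_on_eq_continuous_within case_prod_unfold)
  qed auto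
  then have D: "((\<lambda>(x, t). box_avg h f x t) has_derivative
      (\<lambda>(tx, ty). box_avg_x h f x t * tx + ty * box_avg_t h f x t)) (at (x, t))"
    by (simp add: case_prod_unfold)
  have "((\<lambda>s. (x + s * c, t + s)) has_derivative (\<lambda>s. (s * c, s))) (at 0)"
    by (auto intro!: derivative_eq_intros)
  from has_derivative_compose[OF this, of "\<lambda>(x, t). box_avg h f x t"
      "\<lambda>(tx, ty). box_avg_x h f x t * tx + ty * box_avg_t h f x t"] D
  have "((\<lambda>s. box_avg h f (x + s * c) (t + s)) has_derivative
      (\<lambda>s. box_avg_x h f x t * (s * c) + s * box_avg_t h f x t)) (at 0)"
    by (simp add: case_prod_unfold)
  then show ?thesis
    unfolding has_field_derivative_def
    by (rule has_derivative_eq_rhs) (auto simp: algebra_simps)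
qed

end

context hj_problem
begin

context
  fixes h :: real
  assumes h: "0 < h"
begin

lemmas hopf_lax_cont' = continuous_on_compose_pair[OF hopf_lax_cont]
lemmas time_avg_hopf_lax_cont = time_avg_cont'[OF hopf_lax_cont h]

lemma time_avg_hopf_lax_close: "\<bar>time_avg h hopf_lax x t - hopf_lax x t\<bar> \<le> time_lip * h"
proof -
  have "\<bar>integral {0..h} (\<lambda>s. hopf_lax x (t + s)) / (h - 0) - hopf_lax x t\<bar> \<le> time_lip * h"
  proof (rule average_close)
    show "\<bar>hopf_lax x (t + s) - hopf_lax x t\<bar> \<le> time_lip * h" if "s \<in> {0..h}" for s
    proof -
      have "time_lip * s \<le> time_lip * h" using that time_lip_nonneg by (intro mult_left_mono) auto
      then show ?thesis
        using hopf_lax_lip[of x "t + s" x t] hopf_lax_lip[of x t x "t + s"] that by (simp add: abs_le_iff)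
    qed
    show "continuous_on {0..h} (\<lambda>s. hopf_lax x (t + s))"
      by (intro hopf_lax_cont' continuous_intros)
  qed (use h in auto)
  then show ?thesis by (simp add: time_avg_def)
qed

lemma time_avg_hopf_lax_lip: "time_avg h hopf_lax x t \<le> time_avg h hopf_lax y t + R * \<bar>x - y\<bar>"
proof -
  have "integral {0..h} (\<lambda>s. hopf_lax x (t + s)) / (h - 0)
      \<le> integral {0..h} (\<lambda>s. hopf_lax y (t + s)) / (h - 0) + R * \<bar>x - y\<bar>"
  proof (rule average_mono)
    show "hopf_lax x (t + s) \<le> hopf_lax y (t + s) + R * \<bar>x - y\<bar>" for s
      using hopf_lax_lip[of x "t + s" y "t + s"] by simp
  qed (use h in \<open>auto intro!: hopf_lax_cont' continuous_intros\<close>)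
  then show ?thesis by (simp add: time_avg_def)
qed

lemma box_avg_hopf_lax_close: "\<bar>box_avg h hopf_lax x t - time_avg h hopf_lax x t\<bar> \<le> R * h"
proof -
  have "\<bar>integral {-h..h} (\<lambda>s. time_avg h hopf_lax (x + s) t) / (h - - h) - time_avg h hopf_lax x t\<bar> \<le> R * h"
  proof (rule average_close)
    show "\<bar>time_avg h hopf_lax (x + s) t - time_avg h hopf_lax x t\<bar> \<le> R * h" if "s \<in> {-h..h}" for s
    proof -
      have "R * \<bar>s\<bar> \<le> R * h" using that R_pos by (intro mult_left_mono) auto
      then show ?thesis
        using time_avg_hopf_lax_lip[of "x + s" t x] time_avg_hopf_lax_lip[of x t "x + s"]
        by (simp add: abs_le_iff)
    qed
  qed (use h in \<open>auto intro!: time_avg_hopf_lax_cont continuous_intros\<close>)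
  then show ?thesis by (simp add: box_avg_def)
qed

lemma box_avg_x_hopf_lax_bound: "\<bar>box_avg_x h hopf_lax x t\<bar> \<le> R"
  using time_avg_hopf_lax_lip[of "x + h" t "x - h"] time_avg_hopf_lax_lip[of "x - h" t "x + h"] h
  by (simp add: box_avg_x_def abs_le_iff field_simps)

lemma box_avg_hopf_lax_periodic: "box_avg h hopf_lax (x + 1) t = box_avg h hopf_lax x t"
proof -
  have "hopf_lax (x + 1 + s) r = hopf_lax (x + s) r" for s r
    using hopf_lax_periodic[of "x + s" r] by (simp add: algebra_simps)
  then show ?thesis by (simp add: box_avg_def time_avg_def)
qed

text \<open>
  Averaging preserves the dynamic programming inequality, which at a \<open>C\<^sup>1\<close> function is a
  differential inequality. Taking \<open>q\<close> to be the space derivative makes the average a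
  classical subsolution.
\<close>

lemma box_avg_hopf_lax_subsolution:
  assumes q: "\<bar>q\<bar> \<le> R" and t: "0 \<le> t"
  shows "box_avg_t h hopf_lax x t + H' q * box_avg_x h hopf_lax x t \<le> q * H' q - H q"
proof -
  let ?l = "q * H' q - H q"
  have time: "time_avg h hopf_lax (y + s * H' q) (t + s) \<le> time_avg h hopf_lax y t + s * ?l"
    if s: "0 \<le> s" for y s
  proof -
    have "integral {0..h} (\<lambda>r. hopf_lax (y + s * H' q) (t + s + r)) / (h - 0)
        \<le> integral {0..h} (\<lambda>r. hopf_lax y (t + r)) / (h - 0) + s * ?l"
    proof (rule average_mono)
      show "hopf_lax (y + s * H' q) (t + s + r) \<le> hopf_lax y (t + r) + s * ?l" if "r \<in> {0..h}" for r
        using hopf_lax_dynamic_programming[OF q _ s, of "t + r" y] t that by (simp add: algebra_simps)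
    qed (use h in \<open>auto intro!: hopf_lax_cont' continuous_intros\<close>)
    then show ?thesis by (simp add: time_avg_def)
  qed
  have box: "box_avg h hopf_lax (x + s * H' q) (t + s) \<le> box_avg h hopf_lax x t + s * ?l" if s: "0 \<le> s" for s
  proof -
    have "integral {-h..h} (\<lambda>r. time_avg h hopf_lax (x + s * H' q + r) (t + s)) / (h - - h)
        \<le> integral {-h..h} (\<lambda>r. time_avg h hopf_lax (x + r) t) / (h - - h) + s * ?l"
    proof (rule average_mono)
      show "time_avg h hopf_lax (x + s * H' q + r) (t + s) \<le> time_avg h hopf_lax (x + r) t + s * ?l" for r
        using time[OF s, of "x + r"] by (simp add: algebra_simps)
    qed (use h in \<open>auto intro!: time_avg_hopf_lax_cont continuous_intros\<close>)
    then show ?thesis by (simp add: box_avg_def)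
  qed
  let ?d = "box_avg_x h hopf_lax x t * H' q + box_avg_t h hopf_lax x t - ?l"
  have der: "((\<lambda>s. box_avg h hopf_lax (x + s * H' q) (t + s) - s * ?l) has_real_derivative ?d) (at 0)"
    by (auto intro!: derivative_eq_intros box_avg_line_deriv[OF hopf_lax_cont h])
  have "?d \<le> 0"
  proof (rule ccontr)
    assume "\<not> ?d \<le> 0"
    then obtain e where e: "e > 0" "\<And>s. 0 < s \<Longrightarrow> s < e \<Longrightarrow>
        box_avg h hopf_lax (x + 0 * H' q) (t + 0) - 0 * ?l < box_avg h hopf_lax (x + (0 + s) * H' q) (t + (0 + s)) - (0 + s) * ?l"
      using DERIV_pos_inc_right[OF der] by (metis not_le_imp_less)
    show False using e(2)[of "e / 2"] e(1) box[of "e / 2"] by simp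
  qed
  then show ?thesis by (simp add: algebra_simps)
qed

lemma hopf_lax_le_viscosity_solution:
  assumes u: "viscosity_solution H u0 u" and t: "0 \<le> t"
  shows "hopf_lax x t \<le> u x t + 2 * (R + time_lip) * h"
proof -
  let ?c = "(R + time_lip) * h"
  have close: "\<bar>box_avg h hopf_lax x t - hopf_lax x t\<bar> \<le> ?c" for x t
    using time_avg_hopf_lax_close[of x t] box_avg_hopf_lax_close[of x t] by (simp add: algebra_simps)
  have "box_avg h hopf_lax x t - ?c \<le> u x t"
  proof (rule classical_subsolution_le_viscosity_solution[OF u _ _ _ _ _ _ _ _ t,
        where \<psi>x = "box_avg_x h hopf_lax" and \<psi>t = "box_avg_t h hopf_lax"])
    show "continuous_on (UNIV \<times> {0..}) (\<lambda>(x, t). box_avg h hopf_lax x t - ?c)"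
      unfolding case_prod_unfold
      by (intro continuous_intros continuous_on_compose_pair[OF box_avg_cont[OF hopf_lax_cont h]])
    show "box_avg_t h hopf_lax x t + H (box_avg_x h hopf_lax x t) \<le> 0" if "0 < t" for x t
      using box_avg_hopf_lax_subsolution[OF box_avg_x_hopf_lax_bound[of x t] less_imp_le[OF that], of x]
      by (simp add: algebra_simps)
    show "box_avg h hopf_lax x 0 - ?c \<le> u0 x" for x
      using close[of x 0] by (simp add: hopf_lax_init)
    show "continuous_on (UNIV \<times> {0<..}) (\<lambda>(x, t). box_avg_x h hopf_lax x t)"
      using continuous_on_subset[OF box_avg_x_cont[OF hopf_lax_cont h]] by blast
    show "continuous_on (UNIV \<times> {0<..}) (\<lambda>(x, t). box_avg_t h hopf_lax x t)"
      using continuous_on_subset[OF box_avg_t_cont[OF hopf_lax_cont h]] by blast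
  qed (auto simp: box_avg_hopf_lax_periodic intro!: derivative_eq_intros
      box_avg_deriv_x[OF hopf_lax_cont h] box_avg_deriv_t[OF hopf_lax_cont h])
  then show ?thesis using close[of x t] by (simp add: algebra_simps)
qed

end

end

section \<open>The error estimate\<close>

lemma periodic_summation_by_parts:
  fixes g z :: "real \<Rightarrow> real"
  assumes g: "continuous_on UNIV g" "\<And>x. g (x + 1) = g x"
    and z: "continuous_on UNIV z" "\<And>x. z (x + 1) = z x"
  shows "integral {0..1} (\<lambda>x. g x * (z (x + h) - z (x - h)))
    = - integral {0..1} (\<lambda>x. (g (x + h) - g (x - h)) * z x)"
proof -
  have cont: "continuous_on A (\<lambda>x. g (x + c) * z (x + d))" for A c d
    by (intro continuous_intros continuous_on_compose2[OF g(1)] continuous_on_compose2[OF z(1)]) auto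
  have int: "(\<lambda>x. g (x + c) * z (x + d)) integrable_on {0..1}" for c d
    by (intro integrable_continuous_real cont)
  have per: "g (x + 1 + c) * z (x + 1 + d) = g (x + c) * z (x + d)" for x c d
    using g(2)[of "x + c"] z(2)[of "x + d"] by (simp add: algebra_simps)
  have shift: "integral {0..1} (\<lambda>x. g (x + 0) * z (x + d)) = integral {0..1} (\<lambda>x. g (x + - d) * z (x + 0))" for d
    using periodic_integral_shift[of "\<lambda>x. g (x + - d) * z (x + 0)" d, OF cont per] by simp
  have "integral {0..1} (\<lambda>x. g x * (z (x + h) - z (x - h)))
      = integral {0..1} (\<lambda>x. g (x + 0) * z (x + h) - g (x + 0) * z (x + - h))"
    by (simp add: algebra_simps)
  also have "\<dots> = integral {0..1} (\<lambda>x. g (x + - h) * z (x + 0)) - integral {0..1} (\<lambda>x. g (x + h) * z (x + 0))"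
    by (simp only: Henstock_Kurzweil_Integration.integral_diff[OF int int] shift minus_minus)
  also have "\<dots> = integral {0..1} (\<lambda>x. g (x + - h) * z (x + 0) - g (x + h) * z (x + 0))"
    by (rule Henstock_Kurzweil_Integration.integral_diff[OF int int, symmetric])
  also have "\<dots> = - integral {0..1} (\<lambda>x. (g (x + h) - g (x - h)) * z x)"
    by (subst integral_neg[symmetric]) (simp add: algebra_simps)
  finally show ?thesis .
qed

lemma integral_add_const_01:
  fixes f :: "real \<Rightarrow> real"
  assumes "f integrable_on {0..1}"
  shows "integral {0..1} (\<lambda>x. f x + c) = integral {0..1} f + c"
  using Henstock_Kurzweil_Integration.integral_add[OF assms integrable_const_ivl, of c] by simp

lemma torus_L1_norm_eq:
  assumes "continuous_on UNIV f"
  shows "torus_L1_norm f = integral {0..1} (\<lambda>x. \<bar>f x\<bar>)"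
proof -
  have "set_integrable lborel {0..1} (\<lambda>x. \<bar>f x\<bar>)"
    by (intro borel_integrable_atLeastAtMost' continuous_intros continuous_on_subset[OF assms]) auto
  then have "(LINT x:{0..1}|lborel. \<bar>f x\<bar>) = integral {0..1} (\<lambda>x. \<bar>f x\<bar>)"
    by (rule set_borel_integral_eq_integral)
  then show ?thesis
    by (simp add: torus_L1_norm_def torus_measure_def integral_restrict_space set_lebesgue_integral_def)
qed

context scheme_solution
begin

lemma v_le_hopf_lax:
  assumes "0 \<le> t" "t \<le> T"
  shows "v x t \<le> hopf_lax x t + 4 * \<gamma> * M * T * h"
proof -
  have "v x t - 4 * \<gamma> * M * h * t \<le> hopf_lax x t"
    using v_le_tangent_sol[OF assms(1)] by (intro le_hopf_lax) (simp add: algebra_simps)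
  moreover have "4 * \<gamma> * M * h * t \<le> 4 * \<gamma> * M * h * T"
    using assms gamma_pos M_nonneg h_pos by (intro mult_left_mono) auto
  ultimately show ?thesis by (simp add: algebra_simps)
qed

definition excess :: "real \<Rightarrow> real" where
  "excess t = integral {0..1} (\<lambda>x. box_avg h hopf_lax x t - v x t)"

definition excess_t :: "real \<Rightarrow> real" where
  "excess_t t = integral {0..1} (\<lambda>x. box_avg_t h hopf_lax x t - v_t x t)"

lemma v_slice_cont: "0 \<le> t \<Longrightarrow> continuous_on A (\<lambda>x. v (x + c) t)"
  by (intro continuous_intros) auto

lemmas box_cont = continuous_on_compose_pair[OF box_avg_cont[OF hopf_lax_cont h_pos]]
lemmas box_t_cont = continuous_on_compose_pair[OF box_avg_t_cont[OF hopf_lax_cont h_pos]]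
lemmas time_cont = time_avg_hopf_lax_cont[OF h_pos]

lemma v_t_cont: "continuous_on ({0<..} \<times> A) (\<lambda>(t, x). v_t x t)"
  unfolding v_t_def Dv_def case_prod_unfold using h_pos
  by (intro continuous_intros continuous_on_compose2[OF H_cont[of UNIV]]) auto

lemma excess_deriv:
  assumes "0 < t"
  shows "(excess has_real_derivative excess_t t) (at t)"
proof -
  have "((\<lambda>t. integral (cbox 0 1) (\<lambda>x. box_avg h hopf_lax x t - v x t)) has_field_derivative
      integral (cbox 0 1) (\<lambda>x. box_avg_t h hopf_lax x t - v_t x t)) (at t within {0<..})"
  proof (rule leibniz_rule_field_derivative)
    show "((\<lambda>s. box_avg h hopf_lax x s - v x s) has_real_derivative box_avg_t h hopf_lax x s - v_t x s)
        (at s within {0<..})" if "s \<in> {0<..}" for x s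
      using that by (intro DERIV_diff has_field_derivative_at_within[OF v_deriv]
          has_field_derivative_at_within[OF box_avg_deriv_t[OF hopf_lax_cont h_pos]]) auto
    show "(\<lambda>x. box_avg h hopf_lax x s - v x s) integrable_on cbox 0 1" if "s \<in> {0<..}" for s
      using that by (intro integrable_continuous continuous_intros box_cont) auto
    have "continuous_on ({0<..} \<times> cbox 0 1) (\<lambda>z. box_avg_t h hopf_lax (snd z) (fst z) - (case z of (t, x) \<Rightarrow> v_t x t))"
      by (intro continuous_intros box_t_cont v_t_cont)
    then show "continuous_on ({0<..} \<times> cbox 0 1) (\<lambda>(t, x). box_avg_t h hopf_lax x t - v_t x t)"
      by (simp add: case_prod_unfold)
  qed (use assms in auto)
  then show ?thesis
    using at_within_open[of t "{0<..}"] assms by (simp add: excess_def[abs_def] excess_t_def)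
qed

lemma excess_cont: "continuous_on {0..} excess"
proof -
  have "continuous_on ({0..} \<times> cbox 0 1) (\<lambda>(t, x). box_avg h hopf_lax x t - v x t)"
    unfolding case_prod_unfold by (intro continuous_intros box_cont) auto
  from integral_continuous_on_param[OF this] show ?thesis
    by (simp add: excess_def[abs_def])
qed

lemma H'_Dv_one_sided:
  assumes "0 \<le> t"
  shows "(H' (Dv (x + h) t) - H' (Dv (x - h) t)) / (2 * h) \<le> 2 * K * M"
proof -
  let ?p = "Dv (x + h) t" and ?q = "Dv (x - h) t"
  have "?p - ?q = (v (x + 2 * h) t + v (x - 2 * h) t - 2 * v x t) / (2 * h)"
    using h_pos by (simp add: Dv_def field_simps)
  also have "\<dots> \<le> (8 * M * h\<^sup>2) / (2 * h)"
    using v_semiconcave[OF assms, of x] h_pos by (intro divide_right_mono) auto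
  finally have pq: "?p - ?q \<le> 4 * M * h" using h_pos by (simp add: power2_eq_square)
  have "H' ?p - H' ?q \<le> K * (4 * M * h)"
  proof (cases "?p \<le> ?q")
    case True
    then have "H' ?p - H' ?q \<le> 0" using H'_mono by simp
    also have "0 \<le> K * (4 * M * h)" using K_nonneg M_nonneg h_pos by simp
    finally show ?thesis .
  next
    case False
    then have "H' ?p - H' ?q \<le> K * (?p - ?q)"
      using H'_lip[OF Dv_bound[OF assms] Dv_bound[OF assms], of "x + h" "x - h"] by auto
    also have "\<dots> \<le> K * (4 * M * h)" using pq K_nonneg by (intro mult_left_mono)
    finally show ?thesis .
  qed
  then have "(H' ?p - H' ?q) / (2 * h) \<le> (K * (4 * M * h)) / (2 * h)"
    using h_pos by (intro divide_right_mono) auto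
  then show ?thesis using h_pos by simp
qed

text \<open>
  Convexity linearises \<open>H\<close> at \<open>Dv\<close>, and the numerical viscosity integrates to zero. After
  summation by parts only the one-sided bound on the derivative of \<open>H'(Dv)\<close> is needed, because
  \<open>z + c h\<close> is nonnegative.
\<close>

lemma excess_t_le:
  assumes t: "0 < t" "t \<le> T"
  shows "excess_t t \<le> 2 * K * M * (excess t + (R + time_lip + 4 * \<gamma> * M * T) * h)"
proof -
  let ?V = "hopf_lax"
  define c where "c = (time_lip + 4 * \<gamma> * M * T) * h"
  define g where "g = (\<lambda>x. H' (Dv x t))"
  define z where "z = (\<lambda>x. time_avg h ?V x t - v x t)"
  define S where "S = (\<lambda>x. \<gamma> * (v (x + h) t + v (x - h) t - 2 * v x t) / h)"
  have t0: "0 \<le> t" using t by simp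
  have Dv_cont: "continuous_on A (\<lambda>x. Dv x t)" for A
    unfolding Dv_def using h_pos t0 by (intro continuous_intros) auto
  have g_cont: "continuous_on A g" for A
    unfolding g_def by (intro continuous_on_compose2[OF H'_cont] Dv_cont) auto
  have z_cont: "continuous_on A z" for A
    unfolding z_def using t0 by (intro continuous_intros time_cont) auto
  have S_cont: "continuous_on A S" for A
    unfolding S_def using t0 h_pos by (intro continuous_intros) auto
  have "Dv (x + 1) t = Dv x t" for x
    using v_periodic[OF t0, of "x + h"] v_periodic[OF t0, of "x - h"] by (simp add: Dv_def algebra_simps)
  then have g_per: "g (x + 1) = g x" for x by (simp add: g_def)
  have z_per: "z (x + 1) = z x" for x
    using v_periodic[OF t0] by (simp add: z_def time_avg_def hopf_lax_periodic)
  have g_int: "(\<lambda>x. g (x + d)) integrable_on {0..1}" for d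
    by (intro integrable_continuous_real continuous_on_compose2[OF g_cont[of UNIV]] continuous_intros) auto
  have v_int: "(\<lambda>x. v (x + d) t) integrable_on {0..1}" for d
    by (intro integrable_continuous_real v_slice_cont t0)
  have v_shift: "integral {0..1} (\<lambda>x. v (x + d) t) = integral {0..1} (\<lambda>x. v x t)" for d
    using periodic_integral_shift[of "\<lambda>x. v x t" d] v_slice_cont[OF t0, of UNIV 0] v_periodic[OF t0] by simp
  have int_S: "integral {0..1} S = 0"
  proof -
    have "integral {0..1} S = integral {0..1} (\<lambda>x. (\<gamma> / h) * ((v (x + h) t + v (x + - h) t) - 2 * v (x + 0) t))"
      by (simp add: S_def)
    also have "\<dots> = (\<gamma> / h) * ((integral {0..1} (\<lambda>x. v (x + h) t) + integral {0..1} (\<lambda>x. v (x + - h) t))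
        - 2 * integral {0..1} (\<lambda>x. v (x + 0) t))"
      by (simp only: integral_mult_right Henstock_Kurzweil_Integration.integral_diff
          Henstock_Kurzweil_Integration.integral_add v_int integrable_add integrable_on_mult_right)
    also have "\<dots> = 0" by (simp only: v_shift) simp
    finally show ?thesis .
  qed
  have int_Dg: "integral {0..1} (\<lambda>x. g (x + h) - g (x - h)) = 0"
  proof -
    have "integral {0..1} (\<lambda>x. g (x + h) - g (x + - h))
        = integral {0..1} (\<lambda>x. g (x + h)) - integral {0..1} (\<lambda>x. g (x + - h))"
      by (rule Henstock_Kurzweil_Integration.integral_diff[OF g_int g_int])
    also have "\<dots> = 0"
      by (simp only: periodic_integral_shift[OF g_cont g_per])
    finally show ?thesis by simp
  qed
  have zc: "0 \<le> z x + c" for x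
    using v_le_hopf_lax[OF t0 t(2), of x] time_avg_hopf_lax_close[OF h_pos, of x t]
    by (simp add: z_def c_def algebra_simps abs_le_iff)
  have bx: "box_avg_x h ?V x t - Dv x t = (z (x + h) - z (x - h)) / (2 * h)" for x
    using h_pos by (simp add: box_avg_x_def Dv_def z_def field_simps)
  have cont1: "continuous_on {0..1} (\<lambda>x. - (g x * (z (x + h) - z (x - h))) / (2 * h) - S x)"
    using h_pos by (intro continuous_intros g_cont S_cont continuous_on_compose2[OF z_cont[of UNIV]]) auto
  have cont2: "continuous_on {0..1} (\<lambda>x. g x * (z (x + h) - z (x - h)))"
    by (intro continuous_intros g_cont continuous_on_compose2[OF z_cont[of UNIV]]) auto
  have "excess_t t \<le> integral {0..1} (\<lambda>x. - (g x * (z (x + h) - z (x - h))) / (2 * h) - S x)"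
    unfolding excess_t_def
  proof (rule integral_le)
    have "continuous_on {0..1} (\<lambda>x. case (t, x) of (t, x) \<Rightarrow> v_t x t)"
      by (rule continuous_on_compose2[OF v_t_cont[of UNIV]]) (use t in \<open>auto intro!: continuous_intros\<close>)
    then have "continuous_on {0..1} (\<lambda>x. box_avg_t h ?V x t - v_t x t)"
      by (intro continuous_intros box_t_cont) simp
    then show "(\<lambda>x. box_avg_t h ?V x t - v_t x t) integrable_on {0..1}"
      by (rule integrable_continuous_real)
    show "(\<lambda>x. - (g x * (z (x + h) - z (x - h))) / (2 * h) - S x) integrable_on {0..1}"
      using cont1 by (rule integrable_continuous_real)
    show "box_avg_t h ?V x t - v_t x t \<le> - (g x * (z (x + h) - z (x - h))) / (2 * h) - S x" for x
    proof -
      have "box_avg_t h ?V x t - v_t x t \<le> - (g x * (box_avg_x h ?V x t - Dv x t)) - S x"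
        using box_avg_hopf_lax_subsolution[OF h_pos Dv_bound[OF t0] t0, of x x]
        by (simp add: g_def v_t_def S_def algebra_simps)
      then show ?thesis unfolding bx by simp
    qed
  qed
  also have "\<dots> = integral {0..1} (\<lambda>x. - (1 / (2 * h)) * (g x * (z (x + h) - z (x - h)))) - integral {0..1} S"
    using h_pos
    by (subst Henstock_Kurzweil_Integration.integral_diff)
      (auto intro!: integrable_continuous_real continuous_intros S_cont cont2)
  also have "\<dots> = - (1 / (2 * h)) * integral {0..1} (\<lambda>x. g x * (z (x + h) - z (x - h)))"
    by (simp only: int_S integral_mult_right)
  also have "\<dots> = (1 / (2 * h)) * integral {0..1} (\<lambda>x. (g (x + h) - g (x - h)) * z x)"
    by (simp add: periodic_summation_by_parts[OF g_cont g_per z_cont z_per])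
  also have "\<dots> = (1 / (2 * h)) * integral {0..1} (\<lambda>x. (g (x + h) - g (x - h)) * (z x + c))"
  proof -
    have "integral {0..1} (\<lambda>x. (g (x + h) - g (x - h)) * (z x + c))
        = integral {0..1} (\<lambda>x. (g (x + h) - g (x - h)) * z x + c * (g (x + h) - g (x - h)))"
      by (simp add: algebra_simps)
    also have "\<dots> = integral {0..1} (\<lambda>x. (g (x + h) - g (x - h)) * z x)
        + integral {0..1} (\<lambda>x. c * (g (x + h) - g (x - h)))"
      by (intro Henstock_Kurzweil_Integration.integral_add integrable_continuous_real continuous_intros
          z_cont continuous_on_compose2[OF g_cont[of UNIV]]) auto
    finally show ?thesis by (simp add: int_Dg)
  qed
  also have "\<dots> = integral {0..1} (\<lambda>x. (g (x + h) - g (x - h)) / (2 * h) * (z x + c))"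
    by (simp flip: integral_mult_right)
  also have "\<dots> \<le> integral {0..1} (\<lambda>x. 2 * K * M * (box_avg h ?V x t - v x t + (R * h + c)))"
  proof (rule integral_le)
    show "(\<lambda>x. (g (x + h) - g (x - h)) / (2 * h) * (z x + c)) integrable_on {0..1}"
      using h_pos by (intro integrable_continuous_real continuous_intros
          z_cont continuous_on_compose2[OF g_cont[of UNIV]]) auto
    show "(\<lambda>x. 2 * K * M * (box_avg h ?V x t - v x t + (R * h + c))) integrable_on {0..1}"
      using t0 by (intro integrable_continuous_real continuous_intros box_cont) auto
    show "(g (x + h) - g (x - h)) / (2 * h) * (z x + c) \<le> 2 * K * M * (box_avg h ?V x t - v x t + (R * h + c))" for x
    proof -
      have "(g (x + h) - g (x - h)) / (2 * h) * (z x + c) \<le> 2 * K * M * (z x + c)"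
        using H'_Dv_one_sided[OF t0, of x] zc[of x] unfolding g_def by (intro mult_right_mono)
      also have "\<dots> \<le> 2 * K * M * (box_avg h ?V x t - v x t + (R * h + c))"
        using box_avg_hopf_lax_close[OF h_pos, of x t] K_nonneg M_nonneg
        by (intro mult_left_mono) (auto simp: z_def abs_le_iff)
      finally show ?thesis .
    qed
  qed
  also have "\<dots> = 2 * K * M * (excess t + (R * h + c))"
  proof -
    have "(\<lambda>x. box_avg h ?V x t - v x t) integrable_on {0..1}"
      using t0 by (intro integrable_continuous_real continuous_intros box_cont) auto
    then show ?thesis
      by (simp only: excess_def integral_mult_right integral_add_const_01)
  qed
  finally show ?thesis by (simp add: c_def algebra_simps)
qed

lemma box_avg_close_hopf_lax: "\<bar>box_avg h hopf_lax x t - hopf_lax x t\<bar> \<le> (R + time_lip) * h"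
  using time_avg_hopf_lax_close[OF h_pos, of x t] box_avg_hopf_lax_close[OF h_pos, of x t]
  by (simp add: algebra_simps)

lemma excess_init: "excess 0 \<le> (R + time_lip) * h"
proof -
  have "excess 0 \<le> integral {0..1} (\<lambda>x::real. (R + time_lip) * h)"
    unfolding excess_def
  proof (rule integral_le)
    show "(\<lambda>x. box_avg h hopf_lax x 0 - v x 0) integrable_on {0..1}"
      by (intro integrable_continuous_real continuous_intros box_cont) auto
    show "box_avg h hopf_lax x 0 - v x 0 \<le> (R + time_lip) * h" for x
      using box_avg_close_hopf_lax[of x 0] by (simp add: hopf_lax_init v_init abs_le_iff)
  qed auto
  then show ?thesis by simp
qed

lemma excess_le:
  assumes t: "0 \<le> t" "t \<le> T"
  shows "excess t \<le> 2 * (R + time_lip + 4 * \<gamma> * M * T) * exp (2 * K * M * T) * h"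
proof -
  define k where "k = 2 * K * M"
  define c where "c = (R + time_lip + 4 * \<gamma> * M * T) * h"
  have k: "0 \<le> k" using K_nonneg M_nonneg by (simp add: k_def)
  have rc: "(R + time_lip) * h \<le> c"
    using gamma_pos M_nonneg t h_pos by (simp add: c_def algebra_simps)
  have c: "0 \<le> c"
    using rc R_pos time_lip_nonneg h_pos by (smt (verit) mult_nonneg_nonneg)
  have "(excess t + c) * exp (- k * t) \<le> (excess 0 + c) * exp (- k * 0)"
  proof (rule DERIV_nonpos_imp_decreasing_open[OF t(1)])
    fix s assume s: "0 < s" "s < t"
    have "((\<lambda>s. (excess s + c) * exp (- k * s)) has_real_derivative
        (excess_t s - k * (excess s + c)) * exp (- k * s)) (at s)"
      by (auto intro!: derivative_eq_intros excess_deriv s simp: algebra_simps)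
    moreover have "(excess_t s - k * (excess s + c)) * exp (- k * s) \<le> 0"
      using excess_t_le[of s T] s t by (intro mult_nonpos_nonneg) (auto simp: k_def c_def)
    ultimately show "\<exists>y. ((\<lambda>s. (excess s + c) * exp (- k * s)) has_real_derivative y) (at s) \<and> y \<le> 0"
      by blast
  next
    show "continuous_on {0..t} (\<lambda>s. (excess s + c) * exp (- k * s))"
      by (intro continuous_intros continuous_on_subset[OF excess_cont]) auto
  qed
  then have "(excess t + c) * exp (- k * t) * exp (k * t) \<le> (excess 0 + c) * exp (k * t)"
    by (intro mult_right_mono) auto
  then have "excess t + c \<le> (excess 0 + c) * exp (k * t)"
    by (simp add: mult.assoc flip: exp_add)
  also have "\<dots> \<le> (2 * c) * exp (k * T)"
    using excess_init rc c k t by (intro mult_mono) (auto intro: mult_left_mono)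
  finally show ?thesis using c by (simp add: k_def c_def algebra_simps)
qed

lemma L1_error:
  assumes u: "viscosity_solution H u0 u" and t: "0 \<le> t" "t \<le> T"
  shows "torus_L1_norm (\<lambda>x. v x t - u x t)
    \<le> (2 * (R + time_lip + 4 * \<gamma> * M * T) * exp (2 * K * M * T) + 3 * (R + time_lip) + 8 * \<gamma> * M * T) * h"
proof -
  define X where "X = (3 * (R + time_lip) + 8 * \<gamma> * M * T) * h"
  have u_cont: "continuous_on A (\<lambda>x. u x t)" for A
    using u continuous_on_slice[of "{0..}" u t A] t
    by (auto simp: viscosity_solution_def continuous_on_torus_time_def)
  have v_cont0: "continuous_on A (\<lambda>x. v x t)" for A
    using v_slice_cont[OF t(1), of A 0] by simp
  have pos: "0 \<le> 4 * \<gamma> * M * T * h" "0 \<le> (R + time_lip) * h"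
    using gamma_pos M_nonneg t h_pos R_pos time_lip_nonneg by auto
  have le: "\<bar>v x t - u x t\<bar> \<le> (box_avg h hopf_lax x t - v x t) + X" for x
    using v_le_hopf_lax[OF t, of x] box_avg_close_hopf_lax[of x t] pos
      viscosity_solution_le_hopf_lax[OF u t(1), of x] hopf_lax_le_viscosity_solution[OF h_pos u t(1), of x]
    unfolding X_def abs_le_iff by (auto simp: algebra_simps)
  have int: "(\<lambda>x. box_avg h hopf_lax x t - v x t) integrable_on {0..1}"
    by (intro integrable_continuous_real continuous_intros box_cont v_cont0)
  have "torus_L1_norm (\<lambda>x. v x t - u x t) = integral {0..1} (\<lambda>x. \<bar>v x t - u x t\<bar>)"
    by (intro torus_L1_norm_eq continuous_intros v_cont0 u_cont)
  also have "\<dots> \<le> integral {0..1} (\<lambda>x. (box_avg h hopf_lax x t - v x t) + X)"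
    by (intro integral_le le integrable_continuous_real continuous_intros v_cont0 u_cont box_cont)
  also have "\<dots> = excess t + X"
    using int by (simp only: excess_def integral_add_const_01)
  finally show ?thesis using excess_le[OF t] by (simp add: X_def algebra_simps)
qed

end

section \<open>Smooth data\<close>

lemma smooth_deriv:
  assumes "smooth f"
  shows "((deriv ^^ n) f has_real_derivative (deriv ^^ Suc n) f x) (at x)"
proof -
  have "(deriv ^^ n) f differentiable (at x)"
    using assms by (simp add: smooth_def differentiable_on_def)
  then obtain D where D: "((deriv ^^ n) f has_real_derivative D) (at x)"
    by (auto simp: real_differentiable_def)
  then show ?thesis using DERIV_imp_deriv[OF D] by simp
qed

lemma smooth_deriv_cont:
  assumes "smooth f"
  shows "continuous_on A ((deriv ^^ n) f)"
  using smooth_deriv[OF assms] by (meson DERIV_isCont continuous_at_imp_continuous_on)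

lemma deriv_bounded_imp_lipschitz:
  fixes f f' :: "real \<Rightarrow> real"
  assumes "\<And>z. a \<le> z \<Longrightarrow> z \<le> b \<Longrightarrow> (f has_real_derivative f' z) (at z)"
    and "\<And>z. a \<le> z \<Longrightarrow> z \<le> b \<Longrightarrow> \<bar>f' z\<bar> \<le> K" and "x \<in> {a..b}" "y \<in> {a..b}"
  shows "\<bar>f x - f y\<bar> \<le> K * \<bar>x - y\<bar>"
proof -
  have "norm (f x - f y) \<le> K * norm (x - y)"
    by (rule field_differentiable_bound[of "{a..b}" f f'])
       (use assms in \<open>auto intro: has_field_derivative_at_within\<close>)
  then show ?thesis by simp
qed

lemma smooth_deriv_locally_lipschitz:
  assumes "smooth f"
  shows "\<exists>K\<ge>0. \<forall>p q. \<bar>p\<bar> \<le> B \<longrightarrow> \<bar>q\<bar> \<le> B \<longrightarrow> \<bar>deriv f p - deriv f q\<bar> \<le> K * \<bar>p - q\<bar>"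
proof -
  have "compact ((deriv ^^ 2) f ` {-B..B})"
    by (intro compact_continuous_image smooth_deriv_cont assms) auto
  then obtain K where K: "K > 0" "\<And>p. p \<in> {-B..B} \<Longrightarrow> \<bar>(deriv ^^ 2) f p\<bar> \<le> K"
    using compact_imp_bounded bounded_pos by (metis imageI real_norm_def)
  have "\<bar>deriv f p - deriv f q\<bar> \<le> K * \<bar>p - q\<bar>" if "\<bar>p\<bar> \<le> B" "\<bar>q\<bar> \<le> B" for p q
    using smooth_deriv[OF assms, of 1] K that
    by (intro deriv_bounded_imp_lipschitz[of "-B" B "deriv f" "(deriv ^^ 2) f"])
       (auto simp: numeral_2_eq_2)
  then show ?thesis using K(1) by (intro exI[of _ K]) auto
qed

lemma deriv_periodic:
  fixes f :: "real \<Rightarrow> real"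
  assumes "\<And>x. f (x + 1) = f x"
  shows "deriv f (x + 1) = deriv f x"
proof -
  have "(f has_real_derivative D) (at (x + 1)) \<longleftrightarrow> (f has_real_derivative D) (at x)" for D
    using DERIV_shift[of f D x 1] assms by simp
  then show ?thesis by (simp add: deriv_def)
qed

lemma torus_Linf_norm_le_imp_bound:
  fixes g :: "real \<Rightarrow> real"
  assumes cont: "continuous_on UNIV g" and per: "\<And>x. g (x + 1) = g x"
    and le: "torus_Linf_norm g \<le> ereal R"
  shows "\<bar>g x\<bar> \<le> R"
proof (rule ccontr)
  assume "\<not> \<bar>g x\<bar> \<le> R"
  define S where "S = {y. R < \<bar>g y\<bar>}"
  have S: "open S"
    unfolding S_def by (intro open_Collect_less continuous_intros cont)
  have "frac x \<in> S"
    using \<open>\<not> \<bar>g x\<bar> \<le> R\<close> periodic_frac[of g x] per by (simp add: S_def)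
  then obtain e where e: "e > 0" "ball (frac x) e \<subseteq> S"
    using S open_contains_ball by blast
  define d where "d = min (e / 2) ((1 - frac x) / 2)"
  define y where "y = frac x + d"
  have "0 < d" "d < e" "d < 1 - frac x"
    using e(1) frac_lt_1[of x] by (auto simp: d_def min_def)
  then have "y \<in> ball (frac x) e" "0 < y" "y < 1"
    using frac_ge_0[of x] by (auto simp: y_def dist_real_def intro: add_nonneg_pos)
  moreover from this have "y \<in> S" using e(2) by blast
  ultimately have ne: "S \<inter> {0<..<1} \<noteq> {}" by auto
  have "AE y in torus_measure. ereal \<bar>g y\<bar> \<le> ereal R"
    by (rule eventually_mono[OF esssup_AE]) (rule order_trans[OF _ le[unfolded torus_Linf_norm_def]])
  then have "AE y in lborel. y \<in> {0..1} \<longrightarrow> \<bar>g y\<bar> \<le> R"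
    unfolding torus_measure_def by (subst (asm) AE_restrict_space_iff) auto
  then have "AE y in lborel. y \<notin> S \<inter> {0<..<1}"
    by eventually_elim (auto simp: S_def)
  moreover have "S \<inter> {0<..<1} \<in> sets lborel" using S by auto
  ultimately have "S \<inter> {0<..<1} \<in> null_sets lborel"
    by (subst AE_iff_null_sets) auto
  then have "negligible (S \<inter> {0<..<1})"
    by (simp add: negligible_iff_null_sets null_sets_completionI)
  moreover have "open (S \<inter> {0<..<1})" using S by auto
  ultimately show False using open_not_negligible ne by blast
qed

theorem theorem1p2:
  fixes H u0 :: "real \<Rightarrow> real" and R \<gamma> :: real
  assumes "smooth H" and "convex_on UNIV H" and "coercive H"
    and "periodic_fun_simple' u0" and "smooth u0"
    and "R > 0" and "torus_Linf_norm (deriv u0) \<le> ereal R"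
    and "\<gamma> > 0" and "\<forall>p. \<bar>p\<bar> \<le> R \<longrightarrow> \<bar>deriv H p\<bar> \<le> 2 * \<gamma>"
  shows "\<forall>T>0. \<exists>C>0. \<forall>h>0. \<forall>uh u.
    semidiscrete_solution (num_hamiltonian H \<gamma>) u0 h uh \<and> viscosity_solution H u0 u \<longrightarrow>
    (\<forall>t\<in>{0..T}. torus_L1_norm (\<lambda>x. uh x t - u x t) \<le> C * h)"
proof -
  have H_deriv: "(H has_real_derivative deriv H p) (at p)" for p
    using smooth_deriv[OF assms(1), of 0] by simp
  have u0_deriv: "(u0 has_real_derivative deriv u0 x) (at x)" for x
    using smooth_deriv[OF assms(5), of 0] by simp
  have H_cont: "continuous_on A H" for A
    using smooth_deriv_cont[OF assms(1), of A 0] by simp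
  have H'_cont: "continuous_on A (deriv H)" for A
    using smooth_deriv_cont[OF assms(1), of A 1] by simp
  have u0_per: "u0 (x + 1) = u0 x" for x
    using assms(4) by (rule periodic_fun_simple'.plus_period)
  note u0'_per = deriv_periodic[of u0, OF u0_per]
  have u0''_per: "(deriv ^^ 2) u0 (x + 1) = (deriv ^^ 2) u0 x" for x
    using deriv_periodic[of "deriv u0", OF u0'_per] by (simp add: numeral_2_eq_2)
  obtain K where K: "K \<ge> 0"
    "\<And>p q. \<bar>p\<bar> \<le> R \<Longrightarrow> \<bar>q\<bar> \<le> R \<Longrightarrow> \<bar>deriv H p - deriv H q\<bar> \<le> K * \<bar>p - q\<bar>"
    using smooth_deriv_locally_lipschitz[OF assms(1), of R] by blast
  have "compact ((\<lambda>p. p * deriv H p - H p) ` {-R..R})"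
    by (intro compact_continuous_image continuous_intros H_cont H'_cont) auto
  then obtain L where L: "L > 0" "\<And>p. p \<in> {-R..R} \<Longrightarrow> \<bar>p * deriv H p - H p\<bar> \<le> L"
    using compact_imp_bounded bounded_pos by (metis (mono_tags, lifting) imageI real_norm_def)
  have "continuous_on (UNIV \<times> {0..}) (\<lambda>z::real \<times> real. (deriv ^^ 2) u0 (fst z))"
    by (intro continuous_on_compose2[OF smooth_deriv_cont[OF assms(5), of UNIV 2]] continuous_intros) auto
  then obtain M where M: "M > 0" "\<And>x. \<bar>(deriv ^^ 2) u0 x\<bar> \<le> M"
    using periodic_slab_bounded[of "\<lambda>x t. (deriv ^^ 2) u0 x" 0] u0''_per
    by (auto simp: case_prod_unfold)
  have problem: "hj_problem H (deriv H) u0 (deriv u0) R \<gamma> K L M"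
  proof
    show "H p + deriv H p * (r - p) \<le> H r" for p r
      using convex_on_imp_above_tangent[OF assms(2), of p r "deriv H p"] H_deriv[of p] by simp
    show "\<bar>deriv u0 x\<bar> \<le> R" for x
      using smooth_deriv_cont[OF assms(5), of UNIV 1] u0'_per assms(7)
      by (intro torus_Linf_norm_le_imp_bound) auto
    show "\<bar>deriv u0 x - deriv u0 y\<bar> \<le> M * \<bar>x - y\<bar>" for x y
      using smooth_deriv[OF assms(5), of 1] M(2)
      by (intro deriv_bounded_imp_lipschitz[of "min x y" "max x y" "deriv u0" "(deriv ^^ 2) u0"])
         (auto simp: numeral_2_eq_2)
    show "\<exists>K\<ge>0. \<forall>p q. \<bar>p\<bar> \<le> B \<longrightarrow> \<bar>q\<bar> \<le> B \<longrightarrow> \<bar>deriv H p - deriv H q\<bar> \<le> K * \<bar>p - q\<bar>" for B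
      by (rule smooth_deriv_locally_lipschitz[OF assms(1)])
    show "\<bar>p * deriv H p - H p\<bar> \<le> L" if "\<bar>p\<bar> \<le> R" for p
      using L(2)[of p] that by (auto simp: abs_le_iff)
  qed (use assms H_deriv H'_cont u0_deriv u0_per K L M in auto)
  show ?thesis
  proof (intro allI impI)
    fix T :: real
    assume T: "T > 0"
    interpret hj_problem H "deriv H" u0 "deriv u0" R \<gamma> K L M by (rule problem)
    define C where "C = 2 * (R + time_lip + 4 * \<gamma> * M * T) * exp (2 * K * M * T)
        + 3 * (R + time_lip) + 8 * \<gamma> * M * T"
    have pos: "0 < R + time_lip" "0 < 4 * \<gamma> * M * T" "0 < 8 * \<gamma> * M * T"
      using assms(6,8) time_lip_nonneg M(1) T by (auto intro: add_pos_nonneg)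
    have "0 < 2 * (R + time_lip + 4 * \<gamma> * M * T) * exp (2 * K * M * T)"
      by (rule mult_pos_pos[OF mult_pos_pos[OF zero_less_numeral add_pos_pos[OF pos(1,2)]] exp_gt_zero])
    moreover have "0 < 3 * (R + time_lip)" by (rule mult_pos_pos[OF zero_less_numeral pos(1)])
    ultimately have "C > 0"
      unfolding C_def by (intro add_pos_pos pos(3))
    moreover have "torus_L1_norm (\<lambda>x. uh x t - u x t) \<le> C * h"
      if "h > 0" "semidiscrete_solution (num_hamiltonian H \<gamma>) u0 h uh" "viscosity_solution H u0 u"
        "t \<in> {0..T}" for h uh u t
    proof -
      interpret scheme_solution H "deriv H" u0 "deriv u0" R \<gamma> K L M h uh
        by unfold_locales (use that in auto)
      show ?thesis using L1_error[OF that(3)] that(4) by (simp add: C_def)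
    qed
    ultimately show "\<exists>C>0. \<forall>h>0. \<forall>uh u.
        semidiscrete_solution (num_hamiltonian H \<gamma>) u0 h uh \<and> viscosity_solution H u0 u \<longrightarrow>
        (\<forall>t\<in>{0..T}. torus_L1_norm (\<lambda>x. uh x t - u x t) \<le> C * h)"
      by blast
  qed
qed

end
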